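(* Let $(M,\nabla,h)$ be a generalized pseudo-Hessian manifold, $x\in M$ and $\mathfrak g_x=\ker h_\#(x)\subset T_x^*M$. For $a,b\in\mathfrak g_x$ put $a.b=(\mathcal D_\alpha\beta)(x)$, where $\alpha,\beta$ are differential 1-forms on $M$ with $\alpha(x)=a$ and $\beta(x)=b$. Then this is a well-defined product on $\mathfrak g_x$, and $(\mathfrak g_x,.)$ is a commutative associative algebra.
   Context: All objects are smooth and real. A generalized pseudo-Hessian manifold is a triple $(M,\nabla,h)$ where $\nabla$ is a torsion-free flat linear connection on $M$ and $h$ is a symmetric bivector field (a symmetric section of $TM\otimes TM$, possibly degenerate, viewed as a bilinear form on $T^*M$) such that $(\nabla_{h_\#(\alpha)}h)(\beta,\gamma)=(\nabla_{h_\#(\beta)}h)(\alpha,\gamma)$ for all $\alpha,\beta,\gamma\in\Omega^1(M)$, where $h_\#:T^*M\to TM$ is defined by $\beta(h_\#(\alpha))=h(\alpha,\beta)$. The map $\mathcal D:\Omega^1(M)\times\Omega^1(M)\to\Omega^1(M)$ is defined by $\prec\mathcal D_\alpha\beta,X\succ=(\nabla_Xh)(\alpha,\beta)+\prec\nabla^*_{h_\#(\alpha)}\beta,X\succ$ for all vector fields $X$, where $\prec\cdot,\cdot\succ$ is the duality pairing and $\nabla^*$ is the dual connection on $T^*M$. *)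

theory Defs
  imports "HOL-Analysis.Analysis" "HOL-Library.Function_Algebras"
begin

section \<open>Smooth maps between open subsets of normed spaces\<close>

text \<open>Only used for open \<open>S\<close> in a finite-dimensional space, where continuity of all iterated
  directional derivatives is the usual notion of being of class \<open>C\<^sup>k\<close>.\<close>

primrec Ck_on :: "nat \<Rightarrow> 'a::real_normed_vector set \<Rightarrow> ('a \<Rightarrow> 'b::real_normed_vector) \<Rightarrow> bool" where
  "Ck_on 0 S f \<longleftrightarrow> continuous_on S f"
| "Ck_on (Suc k) S f \<longleftrightarrow>
     (\<forall>x\<in>S. f differentiable (at x)) \<and> (\<forall>v. Ck_on k S (\<lambda>x. frechet_derivative f (at x) v))"

definition smooth_on :: "'a::real_normed_vector set \<Rightarrow> ('a \<Rightarrow> 'b::real_normed_vector) \<Rightarrow> bool" where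
  "smooth_on S f \<longleftrightarrow> (\<forall>k. Ck_on k S f)"


section \<open>Linear algebra on spaces of real-valued functions\<close>

text \<open>Scalar functions, tangent vectors and cotangent vectors below are all real-valued functions;
  their vector space structure is the pointwise one.\<close>

definition scale_fun :: "real \<Rightarrow> ('z \<Rightarrow> real) \<Rightarrow> 'z \<Rightarrow> real" where
  "scale_fun r u = (\<lambda>z. r * u z)"

interpretation fun_vs: vector_space "scale_fun :: real \<Rightarrow> ('z \<Rightarrow> real) \<Rightarrow> 'z \<Rightarrow> real"
  by unfold_locales (auto simp: scale_fun_def algebra_simps fun_eq_iff)

definition linear_fun_on :: "('z \<Rightarrow> real) set \<Rightarrow> (('z \<Rightarrow> real) \<Rightarrow> real) \<Rightarrow> bool" where
  "linear_fun_on V l \<longleftrightarrow>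
     (\<forall>u\<in>V. \<forall>w\<in>V. l (u + w) = l u + l w) \<and> (\<forall>r. \<forall>u\<in>V. l (scale_fun r u) = r * l u)"

text \<open>Real algebras are not assumed to be unital.\<close>

definition comm_assoc_algebra ::
    "('z \<Rightarrow> real) set \<Rightarrow> (('z \<Rightarrow> real) \<Rightarrow> ('z \<Rightarrow> real) \<Rightarrow> 'z \<Rightarrow> real) \<Rightarrow> bool" where
  "comm_assoc_algebra V m \<longleftrightarrow>
     fun_vs.subspace V \<and>
     (\<forall>a\<in>V. \<forall>b\<in>V. m a b \<in> V) \<and>
     (\<forall>a\<in>V. \<forall>b\<in>V. \<forall>c\<in>V. m (a + b) c = m a c + m b c \<and> m c (a + b) = m c a + m c b) \<and>
     (\<forall>r. \<forall>a\<in>V. \<forall>b\<in>V. m (scale_fun r a) b = scale_fun r (m a b) \<and>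
        m a (scale_fun r b) = scale_fun r (m a b)) \<and>
     (\<forall>a\<in>V. \<forall>b\<in>V. m a b = m b a) \<and>
     (\<forall>a\<in>V. \<forall>b\<in>V. \<forall>c\<in>V. m (m a b) c = m a (m b c))"


section \<open>Smooth manifolds\<close>

text \<open>The manifold is the whole type \<open>'m\<close>, with the smooth structure given by an atlas of charts
  \<open>(U, \<phi>)\<close> modelled on the Euclidean space \<open>'e\<close>. The values of \<open>\<phi>\<close> outside \<open>U\<close> are irrelevant.\<close>

type_synonym ('m, 'e) chart = "'m set \<times> ('m \<Rightarrow> 'e)"

definition is_chart :: "('m::topological_space, 'e::euclidean_space) chart \<Rightarrow> bool" where
  "is_chart c \<longleftrightarrow> (case c of (U, \<phi>) \<Rightarrow>
     open U \<and> open (\<phi> ` U) \<and> homeomorphism U (\<phi> ` U) \<phi> (inv_into U \<phi>))"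

definition smooth_atlas :: "('m::topological_space, 'e::euclidean_space) chart set \<Rightarrow> bool" where
  "smooth_atlas A \<longleftrightarrow>
     (\<forall>c\<in>A. is_chart c) \<and> (\<Union>(U, \<phi>)\<in>A. U) = UNIV \<and>
     (\<forall>(U, \<phi>)\<in>A. \<forall>(V, \<psi>)\<in>A. smooth_on (\<phi> ` (U \<inter> V)) (\<psi> \<circ> inv_into U \<phi>))"

definition smooth_fun_on ::
    "('m::topological_space, 'e::euclidean_space) chart set \<Rightarrow> 'm set \<Rightarrow> ('m \<Rightarrow> real) \<Rightarrow> bool" where
  "smooth_fun_on A W f \<longleftrightarrow> (\<forall>(U, \<phi>)\<in>A. smooth_on (\<phi> ` (U \<inter> W)) (f \<circ> inv_into U \<phi>))"

text \<open>Representatives of germs of smooth functions at \<open>p\<close>.\<close>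

definition smooth_near ::
    "('m::topological_space, 'e::euclidean_space) chart set \<Rightarrow> 'm \<Rightarrow> ('m \<Rightarrow> real) set" where
  "smooth_near A p = {f. \<exists>W. open W \<and> p \<in> W \<and> smooth_fun_on A W f}"


section \<open>Tangent and cotangent vectors, vector fields and one-forms\<close>

type_synonym 'm tvec = "('m \<Rightarrow> real) \<Rightarrow> real"
type_synonym 'm covec = "'m tvec \<Rightarrow> real"
type_synonym 'm vfield = "'m \<Rightarrow> 'm tvec"
type_synonym 'm oneform = "'m \<Rightarrow> 'm covec"
type_synonym 'm bivector = "'m \<Rightarrow> 'm covec \<Rightarrow> 'm covec \<Rightarrow> real"
type_synonym 'm connection = "'m vfield \<Rightarrow> 'm vfield \<Rightarrow> 'm vfield"

text \<open>Tangent vectors are derivations at \<open>p\<close>, normalised to be zero outside their domain so that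
  equality of functions is equality of tangent vectors; similarly for cotangent vectors. The value
  of a derivation depends only on the germ of its argument: if \<open>f = g\<close> on a neighbourhood \<open>W\<close> of
  \<open>p\<close>, then \<open>f - g = u * (f - g)\<close> for the indicator function \<open>u\<close> of the complement of \<open>W\<close>, which is
  zero near \<open>p\<close>.\<close>

definition tangent_space ::
    "('m::topological_space, 'e::euclidean_space) chart set \<Rightarrow> 'm \<Rightarrow> 'm tvec set" where
  "tangent_space A p = {v. linear_fun_on (smooth_near A p) v \<and>
     (\<forall>f\<in>smooth_near A p. \<forall>g\<in>smooth_near A p. v (f * g) = f p * v g + g p * v f) \<and>
     (\<forall>f. f \<notin> smooth_near A p \<longrightarrow> v f = 0)}"

definition cotangent_space ::
    "('m::topological_space, 'e::euclidean_space) chart set \<Rightarrow> 'm \<Rightarrow> 'm covec set" where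
  "cotangent_space A p =
     {a. linear_fun_on (tangent_space A p) a \<and> (\<forall>v. v \<notin> tangent_space A p \<longrightarrow> a v = 0)}"

definition apply_field :: "'m vfield \<Rightarrow> ('m \<Rightarrow> real) \<Rightarrow> 'm \<Rightarrow> real" where
  "apply_field X f = (\<lambda>p. X p f)"

definition pairing :: "'m oneform \<Rightarrow> 'm vfield \<Rightarrow> 'm \<Rightarrow> real" where
  "pairing \<alpha> X = (\<lambda>p. \<alpha> p (X p))"

definition fun_times_field :: "('m \<Rightarrow> real) \<Rightarrow> 'm vfield \<Rightarrow> 'm vfield" where
  "fun_times_field f X = (\<lambda>p. scale_fun (f p) (X p))"

definition vector_fields ::
    "('m::topological_space, 'e::euclidean_space) chart set \<Rightarrow> 'm vfield set" where
  "vector_fields A = {X. (\<forall>p. X p \<in> tangent_space A p) \<and>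
     (\<forall>W f. open W \<longrightarrow> smooth_fun_on A W f \<longrightarrow> smooth_fun_on A W (apply_field X f))}"

definition one_forms ::
    "('m::topological_space, 'e::euclidean_space) chart set \<Rightarrow> 'm oneform set" where
  "one_forms A = {\<alpha>. (\<forall>p. \<alpha> p \<in> cotangent_space A p) \<and>
     (\<forall>X\<in>vector_fields A. smooth_fun_on A UNIV (pairing \<alpha> X))}"

definition lie_bracket ::
    "('m::topological_space, 'e::euclidean_space) chart set \<Rightarrow>
     'm vfield \<Rightarrow> 'm vfield \<Rightarrow> 'm vfield" where
  "lie_bracket A X Y = (\<lambda>p f. if f \<in> smooth_near A p
     then X p (apply_field Y f) - Y p (apply_field X f) else 0)"


section \<open>Linear connections\<close>

definition is_connection ::
    "('m::topological_space, 'e::euclidean_space) chart set \<Rightarrow> 'm connection \<Rightarrow> bool" where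
  "is_connection A nabla \<longleftrightarrow>
     (\<forall>X\<in>vector_fields A. \<forall>Y\<in>vector_fields A. nabla X Y \<in> vector_fields A) \<and>
     (\<forall>X\<in>vector_fields A. \<forall>X'\<in>vector_fields A. \<forall>Y\<in>vector_fields A.
        nabla (X + X') Y = nabla X Y + nabla X' Y) \<and>
     (\<forall>X\<in>vector_fields A. \<forall>Y\<in>vector_fields A. \<forall>Y'\<in>vector_fields A.
        nabla X (Y + Y') = nabla X Y + nabla X Y') \<and>
     (\<forall>f X Y. smooth_fun_on A UNIV f \<longrightarrow> X \<in> vector_fields A \<longrightarrow> Y \<in> vector_fields A \<longrightarrow>
        nabla (fun_times_field f X) Y = fun_times_field f (nabla X Y) \<and>
        nabla X (fun_times_field f Y) =
          fun_times_field f (nabla X Y) + fun_times_field (apply_field X f) Y)"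

definition torsion_free ::
    "('m::topological_space, 'e::euclidean_space) chart set \<Rightarrow> 'm connection \<Rightarrow> bool" where
  "torsion_free A nabla \<longleftrightarrow> (\<forall>X\<in>vector_fields A. \<forall>Y\<in>vector_fields A.
     nabla X Y - nabla Y X = lie_bracket A X Y)"

definition flat ::
    "('m::topological_space, 'e::euclidean_space) chart set \<Rightarrow> 'm connection \<Rightarrow> bool" where
  "flat A nabla \<longleftrightarrow>
     (\<forall>X\<in>vector_fields A. \<forall>Y\<in>vector_fields A. \<forall>Z\<in>vector_fields A.
        nabla X (nabla Y Z) - nabla Y (nabla X Z) - nabla (lie_bracket A X Y) Z = 0)"

text \<open>The dual connection, \<open>\<langle>\<nabla>\<^sup>*\<^sub>X \<beta>, Y\<rangle> = X \<langle>\<beta>, Y\<rangle> - \<langle>\<beta>, \<nabla>\<^sub>X Y\<rangle>\<close>.\<close>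

definition dual_connection ::
    "('m::topological_space, 'e::euclidean_space) chart set \<Rightarrow> 'm connection \<Rightarrow>
     'm vfield \<Rightarrow> 'm oneform \<Rightarrow> 'm oneform" where
  "dual_connection A nabla X \<beta> = (THE \<omega>. \<omega> \<in> one_forms A \<and>
     (\<forall>Y\<in>vector_fields A. pairing \<omega> Y = apply_field X (pairing \<beta> Y) - pairing \<beta> (nabla X Y)))"


section \<open>Generalized pseudo-Hessian manifolds\<close>

definition eval_bivector :: "'m bivector \<Rightarrow> 'm oneform \<Rightarrow> 'm oneform \<Rightarrow> 'm \<Rightarrow> real" where
  "eval_bivector h \<alpha> \<beta> = (\<lambda>p. h p (\<alpha> p) (\<beta> p))"

text \<open>A symmetric section of \<open>TM \<otimes> TM\<close>, seen as a field of symmetric bilinear forms on the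
  cotangent spaces.\<close>

definition symmetric_bivector_field ::
    "('m::topological_space, 'e::euclidean_space) chart set \<Rightarrow> 'm bivector \<Rightarrow> bool" where
  "symmetric_bivector_field A h \<longleftrightarrow>
     (\<forall>p. \<forall>a\<in>cotangent_space A p. linear_fun_on (cotangent_space A p) (h p a)) \<and>
     (\<forall>p. \<forall>a\<in>cotangent_space A p. \<forall>b\<in>cotangent_space A p. h p a b = h p b a) \<and>
     (\<forall>\<alpha>\<in>one_forms A. \<forall>\<beta>\<in>one_forms A. smooth_fun_on A UNIV (eval_bivector h \<alpha> \<beta>))"

definition sharp ::
    "('m::topological_space, 'e::euclidean_space) chart set \<Rightarrow> 'm bivector \<Rightarrow>
     'm \<Rightarrow> 'm covec \<Rightarrow> 'm tvec" where
  "sharp A h p a = (THE v. v \<in> tangent_space A p \<and> (\<forall>b\<in>cotangent_space A p. b v = h p a b))"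

definition sharp_field ::
    "('m::topological_space, 'e::euclidean_space) chart set \<Rightarrow> 'm bivector \<Rightarrow>
     'm oneform \<Rightarrow> 'm vfield" where
  "sharp_field A h \<alpha> = (\<lambda>p. sharp A h p (\<alpha> p))"

text \<open>\<open>(\<nabla>\<^sub>X h)(\<alpha>, \<beta>) = X (h(\<alpha>, \<beta>)) - h(\<nabla>\<^sup>*\<^sub>X \<alpha>, \<beta>) - h(\<alpha>, \<nabla>\<^sup>*\<^sub>X \<beta>)\<close>\<close>

definition cov_deriv_bivector ::
    "('m::topological_space, 'e::euclidean_space) chart set \<Rightarrow> 'm connection \<Rightarrow> 'm bivector \<Rightarrow>
     'm vfield \<Rightarrow> 'm oneform \<Rightarrow> 'm oneform \<Rightarrow> 'm \<Rightarrow> real" where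
  "cov_deriv_bivector A nabla h X \<alpha> \<beta> =
     apply_field X (eval_bivector h \<alpha> \<beta>)
     - eval_bivector h (dual_connection A nabla X \<alpha>) \<beta>
     - eval_bivector h \<alpha> (dual_connection A nabla X \<beta>)"

definition generalized_pseudo_Hessian ::
    "('m::topological_space, 'e::euclidean_space) chart set \<Rightarrow> 'm connection \<Rightarrow>
     'm bivector \<Rightarrow> bool" where
  "generalized_pseudo_Hessian A nabla h \<longleftrightarrow>
     is_connection A nabla \<and> torsion_free A nabla \<and> flat A nabla \<and>
     symmetric_bivector_field A h \<and>
     (\<forall>\<alpha>\<in>one_forms A. \<forall>\<beta>\<in>one_forms A. \<forall>\<gamma>\<in>one_forms A.
        cov_deriv_bivector A nabla h (sharp_field A h \<alpha>) \<beta> \<gamma> =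
        cov_deriv_bivector A nabla h (sharp_field A h \<beta>) \<alpha> \<gamma>)"

definition D_map ::
    "('m::topological_space, 'e::euclidean_space) chart set \<Rightarrow> 'm connection \<Rightarrow> 'm bivector \<Rightarrow>
     'm oneform \<Rightarrow> 'm oneform \<Rightarrow> 'm oneform" where
  "D_map A nabla h \<alpha> \<beta> = (THE \<omega>. \<omega> \<in> one_forms A \<and>
     (\<forall>X\<in>vector_fields A. pairing \<omega> X =
        cov_deriv_bivector A nabla h X \<alpha> \<beta>
        + pairing (dual_connection A nabla (sharp_field A h \<alpha>) \<beta>) X))"

definition isotropy ::
    "('m::topological_space, 'e::euclidean_space) chart set \<Rightarrow> 'm bivector \<Rightarrow> 'm \<Rightarrow>
     'm covec set" where
  "isotropy A h x = {a \<in> cotangent_space A x. sharp A h x a = 0}"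

definition is_product_value ::
    "('m::topological_space, 'e::euclidean_space) chart set \<Rightarrow> 'm connection \<Rightarrow> 'm bivector \<Rightarrow>
     'm \<Rightarrow> 'm covec \<Rightarrow> 'm covec \<Rightarrow> 'm covec \<Rightarrow> bool" where
  "is_product_value A nabla h x a b c \<longleftrightarrow>
     (\<exists>\<alpha>\<in>one_forms A. \<exists>\<beta>\<in>one_forms A. \<alpha> x = a \<and> \<beta> x = b \<and> c = D_map A nabla h \<alpha> \<beta> x)"

definition isotropy_product ::
    "('m::topological_space, 'e::euclidean_space) chart set \<Rightarrow> 'm connection \<Rightarrow> 'm bivector \<Rightarrow>
     'm \<Rightarrow> 'm covec \<Rightarrow> 'm covec \<Rightarrow> 'm covec" where
  "isotropy_product A nabla h x a b = (THE c. is_product_value A nabla h x a b c)"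

end

theory Submission
  imports Defs "HOL-Real_Asymp.Real_Asymp"
begin

text \<open>If \<open>a\<close> and \<open>b\<close> lie in the kernel of \<open>h\<^sub>#\<close> at \<open>x\<close>, every connection term in
  \<open>\<langle>D\<^sub>\<alpha> \<beta>, X\<rangle>\<close> vanishes at \<open>x\<close> and the product becomes \<open>(a.b)(v) = v (h(\<alpha>, \<beta>))\<close>, which depends only on
  \<open>a\<close> and \<open>b\<close> and is symmetric. With \<open>T(\<beta>, \<gamma>)\<close> denoting the one-form \<open>X \<mapsto> (\<nabla>\<^sub>X h)(\<beta>, \<gamma>)\<close>, the
  Codazzi equation reads \<open>h(\<alpha>, T(\<beta>, \<gamma>)) = h(\<beta>, T(\<alpha>, \<gamma>))\<close>. At \<open>x\<close> it shows that the kernel is closed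
  under the product; since \<open>T(\<beta>, \<gamma>)\<close> extends \<open>b.c\<close>, differentiating it along \<open>v\<close> at \<open>x\<close> gives
  \<open>a.(b.c) = b.(a.c)\<close>, which together with commutativity is associativity.\<close>

section \<open>Calculus of \<open>C\<^sup>k\<close> maps\<close>

text \<open>A connection term dies at \<open>x\<close> for one of two reasons. If a dual derivative
  fills one slot of \<open>h\<close>, the other slot holds a kernel covector. If the derivative is
  taken along the sharp of \<alpha>, it is tensorial in that direction, which vanishes at
  \<open>x\<close>. That the product depends on \<open>a\<close> and \<open>b\<close> only is less
  clear, since \<open>v (h(\<alpha>, \<beta>))\<close> involves first derivatives of the forms: it
  is tensorial in \<alpha> because the other factor in the product rule, the value of
  \<open>h(\<alpha>, \<beta>)\<close> at \<open>x\<close>, is zero.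

  The shape of the development comes from the definitions. The dual connection, the sharp map and
  \<open>D_map\<close> are unique descriptions, the connection acts on global fields only, and
  tangent vectors are abstract derivations. Before anything can be computed, the descriptions must
  be shown to denote. For one-forms this is the criterion that a functional on vector fields which
  is linear over smooth functions is a one-form. It rests on globally defined frames, hence on bump
  functions, and on the coordinate formula for derivations, hence on Hadamard's lemma.\<close>

lemma Ck_on_SucI:
  assumes "\<And>x. x \<in> S \<Longrightarrow> (f has_derivative f' x) (at x)"
    and "\<And>v. Ck_on k S (\<lambda>x. frechet_derivative f (at x) v)"
  shows "Ck_on (Suc k) S f"
  using assms by (auto simp: differentiable_def)

lemma Ck_on_Suc_has_derivative:
  "Ck_on (Suc k) S f \<Longrightarrow> x \<in> S \<Longrightarrow> (f has_derivative frechet_derivative f (at x)) (at x)"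
  by (simp add: frechet_derivative_works[symmetric])

lemma Ck_on_subset: "Ck_on k S f \<Longrightarrow> T \<subseteq> S \<Longrightarrow> Ck_on k T f"
  by (induction k arbitrary: f) (auto intro: continuous_on_subset)

text \<open>The derivative \<open>at x\<close> sees a full neighbourhood of \<open>x\<close>, so
  agreement on \<open>S\<close> transfers derivatives only because \<open>S\<close> is open. The
  derivatives then agree on \<open>S\<close> as well, which feeds the induction.\<close>

lemma Ck_on_cong:
  assumes "open S" "\<And>x. x \<in> S \<Longrightarrow> f x = g x" "Ck_on k S f"
  shows "Ck_on k S g"
  using assms(2,3)
proof (induction k arbitrary: f g)
  case 0
  then show ?case by (simp cong: continuous_on_cong)
next
  case (Suc k)
  have d: "(g has_derivative frechet_derivative f (at x)) (at x)" if "x \<in> S" for x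
    using has_derivative_transform_within_open[OF Ck_on_Suc_has_derivative[OF Suc.prems(2) that]
        \<open>open S\<close> that] Suc.prems(1) by blast
  show ?case
  proof (rule Ck_on_SucI[OF d])
    fix v
    show "Ck_on k S (\<lambda>x. frechet_derivative g (at x) v)"
    proof (rule Suc.IH)
      show "Ck_on k S (\<lambda>x. frechet_derivative f (at x) v)" using Suc.prems(2) by simp
      show "frechet_derivative f (at x) v = frechet_derivative g (at x) v" if "x \<in> S" for x
        using frechet_derivative_at[OF d[OF that]] by (rule arg_cong)
    qed
  qed
qed

text \<open>The working introduction rule: \<open>frechet_derivative\<close> is a choice, and by
  uniqueness of derivatives any explicit formula \<open>f'\<close> may stand in for it.\<close>

lemma Ck_on_SucI':
  assumes "open S" and d: "\<And>x. x \<in> S \<Longrightarrow> (f has_derivative f' x) (at x)"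
    and "\<And>v. Ck_on k S (\<lambda>x. f' x v)"
  shows "Ck_on (Suc k) S f"
proof (rule Ck_on_SucI[OF d])
  fix v
  show "Ck_on k S (\<lambda>x. frechet_derivative f (at x) v)"
  proof (rule Ck_on_cong[OF assms(1) _ assms(3)])
    show "f' x v = frechet_derivative f (at x) v" if "x \<in> S" for x
      using frechet_derivative_at[OF d[OF that]] by (rule arg_cong)
  qed
qed

text \<open>Derivatives in \<open>Ck_on\<close> are taken \<open>at x\<close>, not within the set,
  so passing to a smaller neighbourhood does not change the functions that the recursion
  examines.\<close>

lemma Ck_on_local:
  assumes "\<And>x. x \<in> S \<Longrightarrow> \<exists>T. open T \<and> x \<in> T \<and> Ck_on k T f"
  shows "Ck_on k S f"
  using assms
proof (induction k arbitrary: f)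
  case 0
  then have "isCont f x" if "x \<in> S" for x
    using that by (metis Ck_on.simps(1) continuous_on_eq_continuous_at)
  then show ?case by (simp add: continuous_at_imp_continuous_on)
next
  case (Suc k)
  have "Ck_on k S (\<lambda>x. frechet_derivative f (at x) v)" for v
  proof (rule Suc.IH)
    fix x assume "x \<in> S"
    then show "\<exists>T. open T \<and> x \<in> T \<and> Ck_on k T (\<lambda>x. frechet_derivative f (at x) v)"
      using Suc.prems[of x] by auto
  qed
  then show ?case using Suc.prems by auto
qed

lemma Ck_on_Suc_D: "Ck_on (Suc k) S f \<Longrightarrow> Ck_on k S f"
proof (induction k arbitrary: f)
  case 0
  then show ?case
    by (auto intro!: continuous_at_imp_continuous_on differentiable_imp_continuous_within)
qed simp

lemma Ck_on_const: "Ck_on k S (\<lambda>x. c)"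
  by (induction k arbitrary: c) auto

lemma Ck_on_add:
  assumes "open S" "Ck_on k S f" "Ck_on k S g"
  shows "Ck_on k S (\<lambda>x. f x + g x)"
  using assms(2,3)
proof (induction k arbitrary: f g)
  case 0
  then show ?case by (simp add: continuous_on_add)
next
  case (Suc k)
  show ?case
    by (rule Ck_on_SucI'[OF \<open>open S\<close> has_derivative_add[OF
          Ck_on_Suc_has_derivative[OF Suc.prems(1)] Ck_on_Suc_has_derivative[OF Suc.prems(2)]]])
      (use Suc in auto)
qed

lemma Ck_on_sum:
  assumes "open S" "\<And>i. i \<in> I \<Longrightarrow> Ck_on k S (f i)"
  shows "Ck_on k S (\<lambda>x. \<Sum>i\<in>I. f i x)"
  using assms(2) by (induction I rule: infinite_finite_induct) (auto intro: Ck_on_const intro!: Ck_on_add[OF assms(1)])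

lemma Ck_on_bounded_linear:
  assumes "open S" "bounded_linear L" "Ck_on k S f"
  shows "Ck_on k S (\<lambda>x. L (f x))"
  using assms(3)
proof (induction k arbitrary: f)
  case 0
  then show ?case by (simp add: bounded_linear.continuous_on[OF assms(2)])
next
  case (Suc k)
  show ?case
    by (rule Ck_on_SucI'[OF \<open>open S\<close> bounded_linear.has_derivative[OF assms(2)
          Ck_on_Suc_has_derivative[OF Suc.prems]]]) (use Suc in auto)
qed

lemma Ck_on_id: "Ck_on k S (\<lambda>x. x)"
proof -
  \<comment> \<open>\<open>S\<close> need not be open here, so the derivative rule is applied on the
    whole space and the result restricted.\<close>
  have "Ck_on k UNIV (\<lambda>x. x)"
    by (cases k) (auto intro!: Ck_on_SucI'[OF _ has_derivative_ident] Ck_on_const)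
  then show ?thesis by (rule Ck_on_subset) simp
qed

lemma Ck_on_scaleR:
  fixes f :: "'a::real_normed_vector \<Rightarrow> real" and g :: "'a \<Rightarrow> 'b::real_normed_vector"
  assumes "open S" "Ck_on k S f" "Ck_on k S g"
  shows "Ck_on k S (\<lambda>x. f x *\<^sub>R g x)"
  using assms(2,3)
proof (induction k arbitrary: f g)
  case 0
  then show ?case by (simp add: continuous_on_scaleR)
next
  case (Suc k)
  show ?case
  proof (rule Ck_on_SucI'[OF \<open>open S\<close> has_derivative_scaleR[OF
          Ck_on_Suc_has_derivative[OF Suc.prems(1)] Ck_on_Suc_has_derivative[OF Suc.prems(2)]]])
    fix v
    show "Ck_on k S (\<lambda>x. f x *\<^sub>R frechet_derivative g (at x) v
            + frechet_derivative f (at x) v *\<^sub>R g x)"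
      using Suc Ck_on_Suc_D[OF Suc.prems(1)] Ck_on_Suc_D[OF Suc.prems(2)]
      by (intro Ck_on_add[OF \<open>open S\<close>]) auto
  qed
qed

lemma Ck_on_mult:
  fixes f g :: "'a::real_normed_vector \<Rightarrow> real"
  assumes "open S" "Ck_on k S f" "Ck_on k S g"
  shows "Ck_on k S (\<lambda>x. f x * g x)"
  using Ck_on_scaleR[OF assms] by simp

text \<open>The chain rule evaluates the derivative of \<open>g\<close> in the direction
  \<open>Du x v\<close>, which varies with \<open>x\<close>, whereas \<open>Ck_on\<close> controls
  derivatives in fixed directions only. Expanding the direction in \<open>Basis\<close> gives a
  finite sum of products to which the induction hypothesis applies; this is why the middle space is
  Euclidean.\<close>

lemma Ck_on_compose:
  fixes u :: "'a::real_normed_vector \<Rightarrow> 'b::euclidean_space"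
    and g :: "'b \<Rightarrow> 'c::real_normed_vector"
  assumes S: "open S" and u: "Ck_on k S u" and g: "Ck_on k T g" and "u ` S \<subseteq> T"
  shows "Ck_on k S (\<lambda>x. g (u x))"
  using u g
proof (induction k arbitrary: g)
  case 0
  then show ?case using \<open>u ` S \<subseteq> T\<close> by (auto intro: continuous_on_compose2)
next
  case (Suc k)
  let ?Du = "\<lambda>x. frechet_derivative u (at x)" and ?Dg = "\<lambda>y. frechet_derivative g (at y)"
  note du = Ck_on_Suc_has_derivative[OF Suc.prems(1)]
  have dg: "(g has_derivative ?Dg (u x)) (at (u x))" if "x \<in> S" for x
    using Ck_on_Suc_has_derivative[OF Suc.prems(2)] \<open>u ` S \<subseteq> T\<close> that by blast
  have d: "((\<lambda>x. g (u x)) has_derivative (\<lambda>v. \<Sum>i\<in>Basis. (?Du x v \<bullet> i) *\<^sub>R ?Dg (u x) i)) (at x)"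
    if "x \<in> S" for x
  proof -
    have eq: "?Dg (u x) w = (\<Sum>i\<in>Basis. (w \<bullet> i) *\<^sub>R ?Dg (u x) i)" for w
    proof -
      have "linear (?Dg (u x))" using dg[OF that] by (simp add: has_derivative_linear)
      then have "?Dg (u x) (\<Sum>i\<in>Basis. (w \<bullet> i) *\<^sub>R i) = (\<Sum>i\<in>Basis. (w \<bullet> i) *\<^sub>R ?Dg (u x) i)"
        by (simp add: linear_sum linear_scale)
      then show ?thesis by (simp add: euclidean_representation)
    qed
    show ?thesis
      using has_derivative_compose[OF du[OF that] dg[OF that]]
      by (rule has_derivative_eq_rhs) (rule ext, rule eq)
  qed
  show ?case
  proof (rule Ck_on_SucI'[OF S d])
    fix v
    show "Ck_on k S (\<lambda>x. \<Sum>i\<in>Basis. (?Du x v \<bullet> i) *\<^sub>R ?Dg (u x) i)"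
    proof (intro Ck_on_sum[OF S] Ck_on_scaleR[OF S])
      fix i :: 'b
      show "Ck_on k S (\<lambda>x. ?Du x v \<bullet> i)"
        using Suc.prems(1) by (intro Ck_on_bounded_linear[OF S bounded_linear_inner_left]) auto
      show "Ck_on k S (\<lambda>x. ?Dg (u x) i)"
        using Suc.IH[OF Ck_on_Suc_D[OF Suc.prems(1)], of "\<lambda>y. ?Dg y i"] Suc.prems(2) by auto
    qed
  qed simp
qed

lemma smooth_on_subset: "smooth_on S f \<Longrightarrow> T \<subseteq> S \<Longrightarrow> smooth_on T f"
  unfolding smooth_on_def using Ck_on_subset by blast

lemma smooth_on_cong:
  "smooth_on S f \<Longrightarrow> open S \<Longrightarrow> (\<And>x. x \<in> S \<Longrightarrow> f x = g x) \<Longrightarrow> smooth_on S g"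
  unfolding smooth_on_def using Ck_on_cong[of S f g] by blast

lemma smooth_on_has_derivative:
  "smooth_on S f \<Longrightarrow> x \<in> S \<Longrightarrow> (f has_derivative frechet_derivative f (at x)) (at x)"
  unfolding smooth_on_def using Ck_on_Suc_has_derivative by blast

lemma smooth_on_frechet_derivative:
  "smooth_on S f \<Longrightarrow> smooth_on S (\<lambda>x. frechet_derivative f (at x) v)"
  unfolding smooth_on_def using Ck_on.simps(2) by blast

lemma smooth_on_compose:
  fixes u :: "'a::real_normed_vector \<Rightarrow> 'b::euclidean_space"
  assumes "open S" "smooth_on S u" "smooth_on T g" "u ` S \<subseteq> T"
  shows "smooth_on S (\<lambda>x. g (u x))"
  using assms Ck_on_compose[of S _ u T g] unfolding smooth_on_def by blast

lemma smooth_on_local: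
  assumes "\<And>x. x \<in> S \<Longrightarrow> \<exists>T. open T \<and> x \<in> T \<and> smooth_on T f"
  shows "smooth_on S f"
  unfolding smooth_on_def
proof
  show "Ck_on k S f" for k
    using assms unfolding smooth_on_def by (intro Ck_on_local) blast
qed

lemma smooth_on_add:
  "open S \<Longrightarrow> smooth_on S f \<Longrightarrow> smooth_on S g \<Longrightarrow> smooth_on S (\<lambda>x. f x + g x)"
  by (simp add: smooth_on_def Ck_on_add)

lemma smooth_on_mult:
  fixes f g :: "'a::real_normed_vector \<Rightarrow> real"
  shows "open S \<Longrightarrow> smooth_on S f \<Longrightarrow> smooth_on S g \<Longrightarrow> smooth_on S (\<lambda>x. f x * g x)"
  by (simp add: smooth_on_def Ck_on_mult)

section \<open>Hadamard's lemma\<close>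

text \<open>Differentiation under the integral sign. The weight \<open>t ^ m\<close> is there for
  the induction: each derivative of \<open>f (c + t *\<^sub>R (y - c))\<close> in \<open>y\<close>
  releases a factor \<open>t\<close>, turning \<open>m\<close> into \<open>Suc m\<close>. Hadamard's
  lemma needs \<open>m = 0\<close> only.\<close>

lemma Ck_on_radial_integral:
  fixes f :: "'a::euclidean_space \<Rightarrow> real"
  assumes "Ck_on k (ball c r) f"
  shows "Ck_on k (ball c r) (\<lambda>y. integral {0..1} (\<lambda>t. t ^ m * f (c + t *\<^sub>R (y - c))))"
  using assms
proof (induction k arbitrary: f m)
  have in_ball: "c + t *\<^sub>R (y - c) \<in> ball c r" if "y \<in> ball c r" "t \<in> {0..1}" for y t
  proof -
    have "\<bar>t\<bar> * norm (y - c) \<le> 1 * norm (y - c)" using that by (intro mult_right_mono) auto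
    then show ?thesis using that by (simp add: dist_norm norm_minus_commute)
  qed
  have cont: "continuous_on (ball c r \<times> {0..1}) (\<lambda>(y,t). t ^ m * f (c + t *\<^sub>R (y - c)))"
    if "continuous_on (ball c r) f" for f :: "'a \<Rightarrow> real" and m
    unfolding case_prod_beta
    by (intro continuous_intros continuous_on_compose2[OF that]) (use in_ball in auto)
  {
    case 0
    then show ?case
      using integral_continuous_on_param[of "ball c r" 0 1 "\<lambda>y t. t ^ m * f (c + t *\<^sub>R (y - c))"]
        cont[of f m] by simp
  next
    case (Suc k)
    let ?D = "\<lambda>y. frechet_derivative f (at y)"
    let ?F = "\<lambda>y t. t ^ m * f (c + t *\<^sub>R (y - c))"
    let ?F' = "\<lambda>y t. t ^ Suc m *\<^sub>R Blinfun (?D (c + t *\<^sub>R (y - c)))"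
    note df = Ck_on_Suc_has_derivative[OF Suc.prems]
    have bl: "bounded_linear (?D y)" if "y \<in> ball c r" for y
      using df[OF that] by (rule has_derivative_bounded_linear)
    have contf: "continuous_on (ball c r) f"
      using has_derivative_continuous[OF df] by (simp add: continuous_at_imp_continuous_on)
    have contD: "continuous_on (ball c r) (\<lambda>y. ?D y v)" for v
    proof -
      have "Ck_on k (ball c r) (\<lambda>y. ?D y v)" using Suc.prems by simp
      then have "Ck_on 0 (ball c r) (\<lambda>y. ?D y v)" by (induction k) (use Ck_on_Suc_D in blast)+
      then show ?thesis by simp
    qed
    \<comment> \<open>The Leibniz rule asks for a derivative that is continuous as a bounded linear
      map; in finite dimension, continuity in each fixed direction suffices.\<close>
    have contB: "continuous_on (ball c r) (\<lambda>y. Blinfun (?D y))"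
    proof (rule continuous_on_blinfun_componentwise)
      show "continuous_on (ball c r) (\<lambda>y. blinfun_apply (Blinfun (?D y)) i)" for i
        by (rule continuous_on_eq[OF contD[of i]]) (use bl in \<open>simp add: bounded_linear_Blinfun_apply\<close>)
    qed
    have contF': "continuous_on (ball c r \<times> {0..1}) (\<lambda>(y,t). ?F' y t)"
      unfolding case_prod_beta
      by (intro continuous_intros continuous_on_compose2[OF contB]) (use in_ball in auto)
    have dF: "((\<lambda>y. ?F y t) has_derivative blinfun_apply (?F' y t)) (at y within ball c r)"
      if "y \<in> ball c r" "t \<in> {0..1}" for y t
    proof -
      have "((\<lambda>y. c + t *\<^sub>R (y - c)) has_derivative (\<lambda>v. t *\<^sub>R v)) (at y within ball c r)"
        by (auto intro!: derivative_eq_intros)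
      from has_derivative_compose[OF this df[OF in_ball[OF that]]]
      have "((\<lambda>y. ?F y t) has_derivative (\<lambda>v. t ^ m * ?D (c + t *\<^sub>R (y - c)) (t *\<^sub>R v)))
         (at y within ball c r)"
        by (auto intro!: derivative_eq_intros)
      moreover have "?D (c + t *\<^sub>R (y - c)) (t *\<^sub>R v) = t * ?D (c + t *\<^sub>R (y - c)) v" for v
        using bl[OF in_ball[OF that]] by (simp add: linear_simps)
      ultimately show ?thesis
        using bl[OF in_ball[OF that]]
        by (simp add: bounded_linear_Blinfun_apply scaleR_blinfun.rep_eq mult.assoc mult.left_commute)
    qed
    have integF: "?F y integrable_on {0..1}" if "y \<in> ball c r" for y
      using that by (intro integrable_continuous_interval continuous_intros
          continuous_on_compose2[OF contf]) (use in_ball in auto)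
    have integF': "?F' y integrable_on {0..1}" if "y \<in> ball c r" for y
      using that by (intro integrable_continuous_interval continuous_intros
          continuous_on_compose2[OF contB]) (use in_ball in auto)
    show ?case
    proof (rule Ck_on_SucI')
      fix y assume y: "y \<in> ball c r"
      have "((\<lambda>y. integral {0..1} (?F y)) has_derivative integral {0..1} (?F' y))
          (at y within ball c r)"
        using leibniz_rule[of "ball c r" 0 1 ?F ?F' y] dF integF contF' y by simp
      then have "((\<lambda>y. integral {0..1} (?F y)) has_derivative integral {0..1} (?F' y)) (at y)"
        using at_within_open[OF y] by simp
      moreover have "blinfun_apply (integral {0..1} (?F' y)) v
          = integral {0..1} (\<lambda>t. t ^ Suc m * ?D (c + t *\<^sub>R (y - c)) v)" for v
      proof -
        have "blinfun_apply (integral {0..1} (?F' y)) v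
           = integral {0..1} (\<lambda>t. blinfun_apply (?F' y t) v)"
          by (rule blinfun_apply_integral[OF integF'[OF y]])
        also have "\<dots> = integral {0..1} (\<lambda>t. t ^ Suc m * ?D (c + t *\<^sub>R (y - c)) v)"
          using bl[OF in_ball[OF y]]
          by (intro integral_cong) (simp add: bounded_linear_Blinfun_apply scaleR_blinfun.rep_eq)
        finally show ?thesis .
      qed
      ultimately show "((\<lambda>y. integral {0..1} (?F y)) has_derivative
         (\<lambda>v. integral {0..1} (\<lambda>t. t ^ Suc m * ?D (c + t *\<^sub>R (y - c)) v))) (at y)"
        by (metis (no_types, lifting) ext)
    next
      fix v
      show "Ck_on k (ball c r) (\<lambda>y. integral {0..1} (\<lambda>t. t ^ Suc m * ?D (c + t *\<^sub>R (y - c)) v))"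
        using Suc.prems by (intro Suc.IH) simp
    qed simp
  }
qed

text \<open>The fundamental theorem of calculus along the segment from \<open>c\<close> to
  \<open>y\<close>: \<open>G i\<close> averages the derivative of \<open>f\<close> in direction
  \<open>i\<close> over that segment, so at \<open>y = c\<close> it is the derivative
  itself.\<close>

lemma Hadamard:
  fixes f :: "'a::euclidean_space \<Rightarrow> real"
  assumes "smooth_on (ball c r) f" "r > 0"
  obtains G where "\<And>i. smooth_on (ball c r) (G i)"
    and "\<And>y. y \<in> ball c r \<Longrightarrow> f y = f c + (\<Sum>i\<in>Basis. ((y - c) \<bullet> i) * G i y)"
    and "\<And>i. G i c = frechet_derivative f (at c) i"
proof
  let ?D = "\<lambda>y. frechet_derivative f (at y)"
  define G where "G i y = integral {0..1} (\<lambda>t. t ^ 0 * ?D (c + t *\<^sub>R (y - c)) i)" for i y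
  show "smooth_on (ball c r) (G i)" for i
    unfolding smooth_on_def G_def
    using smooth_on_frechet_derivative[OF assms(1), of i, unfolded smooth_on_def]
    by (intro allI Ck_on_radial_integral) blast
  show "G i c = ?D c i" for i by (simp add: G_def)
  show "f y = f c + (\<Sum>i\<in>Basis. ((y - c) \<bullet> i) * G i y)" if y: "y \<in> ball c r" for y
  proof -
    have in_ball: "c + t *\<^sub>R (y - c) \<in> ball c r" if "t \<in> {0..1}" for t
    proof -
      have "\<bar>t\<bar> * norm (y - c) \<le> 1 * norm (y - c)" using that by (intro mult_right_mono) auto
      then show ?thesis using y by (simp add: dist_norm norm_minus_commute)
    qed
    have lin: "?D z w = (\<Sum>i\<in>Basis. (w \<bullet> i) * ?D z i)" if "z \<in> ball c r" for z w
    proof -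
      have "linear (?D z)"
        using smooth_on_has_derivative[OF assms(1) that] by (simp add: has_derivative_linear)
      then have "?D z (\<Sum>i\<in>Basis. (w \<bullet> i) *\<^sub>R i) = (\<Sum>i\<in>Basis. (w \<bullet> i) * ?D z i)"
        by (simp add: linear_sum linear_scale)
      then show ?thesis by (simp add: euclidean_representation)
    qed
    have contD: "continuous_on (ball c r) (\<lambda>y. ?D y i)" for i
      using smooth_on_frechet_derivative[OF assms(1)] unfolding smooth_on_def
      by (metis Ck_on.simps(1))
    have "((\<lambda>t. ?D (c + t *\<^sub>R (y - c)) (y - c)) has_integral
        f (c + 1 *\<^sub>R (y - c)) - f (c + 0 *\<^sub>R (y - c))) {0..1}"
    proof (rule fundamental_theorem_of_calculus)
      fix t :: real assume t: "t \<in> {0..1}"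
      have "((\<lambda>t. c + t *\<^sub>R (y - c)) has_derivative (\<lambda>s. s *\<^sub>R (y - c))) (at t within {0..1})"
        by (auto intro!: derivative_eq_intros)
      from has_derivative_compose[OF this smooth_on_has_derivative[OF assms(1) in_ball[OF t]]]
      show "((\<lambda>t. f (c + t *\<^sub>R (y - c))) has_vector_derivative ?D (c + t *\<^sub>R (y - c)) (y - c))
          (at t within {0..1})"
        unfolding has_vector_derivative_def
        using has_derivative_linear[OF smooth_on_has_derivative[OF assms(1) in_ball[OF t]]]
        by (simp add: linear_scale)
    qed simp
    then have "f y - f c = integral {0..1} (\<lambda>t. ?D (c + t *\<^sub>R (y - c)) (y - c))"
      by (simp add: has_integral_integrable_integral)
    also have "\<dots> = integral {0..1} (\<lambda>t. \<Sum>i\<in>Basis. ((y - c) \<bullet> i) * ?D (c + t *\<^sub>R (y - c)) i)"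
      using in_ball by (intro integral_cong lin) auto
    also have "\<dots> = (\<Sum>i\<in>Basis. integral {0..1} (\<lambda>t. ((y - c) \<bullet> i) * ?D (c + t *\<^sub>R (y - c)) i))"
      by (intro integral_sum integrable_continuous_interval continuous_intros
          continuous_on_compose2[OF contD]) (use in_ball in auto)
    also have "\<dots> = (\<Sum>i\<in>Basis. ((y - c) \<bullet> i) * G i y)" by (simp add: G_def)
    finally show ?thesis by simp
  qed
qed

section \<open>Bump functions\<close>

text \<open>The family is closed under differentiation up to linear combinations, with members
  \<open>n + 1\<close> and \<open>n + 2\<close> appearing. Smoothness of the classical function
  (\<open>n = 0\<close>) thus follows by induction on the order, for all \<open>n\<close> at
  once.\<close>

definition flat_exp :: "nat \<Rightarrow> real \<Rightarrow> real" where
  "flat_exp n t = (if t > 0 then exp (- inverse t) / t ^ n else 0)"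

lemma has_derivative_flat_exp:
  "(flat_exp n has_derivative (\<lambda>v. v * (flat_exp (n + 2) t + (- real n) * flat_exp (n + 1) t))) (at t)"
proof -
  consider "t > 0" | "t < 0" | "t = 0" by linarith
  then have "(flat_exp n has_real_derivative flat_exp (n + 2) t - n * flat_exp (n + 1) t) (at t)"
  proof cases
    case 1
    have p: "((\<lambda>t. inverse t ^ n) has_real_derivative - real n * inverse t ^ Suc n) (at t)"
    proof (induction n)
      case (Suc n)
      have "((\<lambda>t. inverse t) has_real_derivative - (inverse t * inverse t)) (at t)"
        using 1 by (auto intro!: derivative_eq_intros)
      from DERIV_mult[OF this Suc] show ?case by (simp add: algebra_simps)
    qed simp
    have "((\<lambda>t. exp (- inverse t)) has_real_derivative
       exp (- inverse t) * (inverse t * inverse t)) (at t)"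
      using 1 by (auto intro!: derivative_eq_intros)
    then have "((\<lambda>t. exp (- inverse t) * inverse t ^ n) has_real_derivative
       exp (- inverse t) * inverse t ^ (n + 2) - n * (exp (- inverse t) * inverse t ^ (n + 1))) (at t)"
      by (rule DERIV_cong[OF DERIV_mult[OF _ p]]) (simp add: algebra_simps)
    then have "((\<lambda>t. exp (- inverse t) / t ^ n) has_real_derivative
       flat_exp (n + 2) t - n * flat_exp (n + 1) t) (at t)"
      using 1 by (simp add: flat_exp_def divide_inverse power_inverse)
    then show ?thesis
      by (rule has_field_derivative_transform_within_open[where S = "{0<..}"])
        (use 1 in \<open>auto simp: flat_exp_def\<close>)
  next
    case 2
    have "((\<lambda>t. 0) has_real_derivative flat_exp (n + 2) t - n * flat_exp (n + 1) t) (at t)"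
      using 2 by (auto simp: flat_exp_def)
    then show ?thesis
      by (rule has_field_derivative_transform_within_open[where S = "{..<0}"])
        (use 2 in \<open>auto simp: flat_exp_def\<close>)
  next
    case 3
    \<comment> \<open>At 0 both terms of the claimed derivative are 0, so the difference quotient
      has to tend to 0. On the right, exp (-1/s) beats every power of s; on the left the quotient is
      0.\<close>
    have "((\<lambda>s. flat_exp n s / s) \<longlongrightarrow> 0) (at_right 0)"
    proof -
      have "((\<lambda>s::real. exp (- inverse s) / s ^ n / s) \<longlongrightarrow> 0) (at_right 0)"
        by real_asymp
      then show ?thesis
        by (rule Lim_transform_eventually)
          (auto simp: flat_exp_def eventually_at_right_less intro: eventually_at_rightI[of 0 1])
    qed
    moreover have "((\<lambda>s. flat_exp n s / s) \<longlongrightarrow> 0) (at_left 0)"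
      by (rule tendsto_eventually)
        (auto simp: flat_exp_def intro: eventually_at_leftI[of "-1"])
    ultimately have "((\<lambda>s. flat_exp n s / s) \<longlongrightarrow> 0) (at 0)"
      using filterlim_at_split by blast
    then show ?thesis using 3 by (simp add: DERIV_def flat_exp_def)
  qed
  then show ?thesis
    unfolding has_field_derivative_def by (rule has_derivative_eq_rhs) (simp add: fun_eq_iff)
qed

lemma smooth_on_flat_exp: "smooth_on UNIV (flat_exp n)"
proof -
  have "Ck_on k UNIV (flat_exp n)" for k
  proof (induction k arbitrary: n)
    case 0
    have "isCont (flat_exp n) t" for t
      using has_derivative_continuous[OF has_derivative_flat_exp] .
    then show ?case by (simp add: continuous_at_imp_continuous_on)
  next
    case (Suc k)
    show ?case
      by (rule Ck_on_SucI'[OF open_UNIV has_derivative_flat_exp])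
        (intro Ck_on_mult Ck_on_const Ck_on_add Suc open_UNIV)
  qed
  then show ?thesis by (simp add: smooth_on_def)
qed

text \<open>With \<open>F = flat_exp 0\<close>, the function \<open>t \<mapsto> F (F b - F t)\<close> is constant for \<open>t \<le> 0\<close> and vanishes
  for \<open>t \<ge> b\<close>, so it gives a flat-topped bump without dividing smooth functions.\<close>

lemma smooth_bump_Euclidean:
  fixes c :: "'a::euclidean_space"
  assumes "r > 0"
  obtains \<rho> d where "smooth_on UNIV \<rho>" "0 < d" "\<And>y. y \<in> ball c d \<Longrightarrow> \<rho> y = (1::real)"
    "\<And>y. y \<notin> cball c r \<Longrightarrow> \<rho> y = 0"
proof
  \<comment> \<open>The inner argument is t = |y - c|^2 - b. It is negative within distance sqrt b
    of \<open>c\<close>, and it exceeds \<open>b\<close> outside \<open>cball c r\<close> because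
    r^2 = 2 b. The plateau value \<open>flat_exp 0 e\<close> is positive since \<open>e\<close> is,
    so it can be normalised to 1.\<close>
  define b where "b = r\<^sup>2 / 2"
  define e where "e = flat_exp 0 b"
  define \<rho> where "\<rho> y = flat_exp 0 (e + (- 1) * flat_exp 0 ((y - c) \<bullet> (y - c) + (- b))) * inverse (flat_exp 0 e)"
    for y
  have b: "b > 0" using assms by (simp add: b_def)
  then have e: "e > 0" by (simp add: e_def flat_exp_def)
  have "Ck_on k UNIV \<rho>" for k
  proof -
    have F: "Ck_on k UNIV (flat_exp 0)" using smooth_on_flat_exp by (simp add: smooth_on_def)
    have lin: "Ck_on k UNIV (\<lambda>y. (y - c) \<bullet> i)" for i
    proof -
      have "Ck_on k UNIV (\<lambda>y. (y + (- c)) \<bullet> i)"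
        by (intro Ck_on_bounded_linear[OF _ bounded_linear_inner_left] Ck_on_add Ck_on_id Ck_on_const) auto
      then show ?thesis by simp
    qed
    have "Ck_on k UNIV (\<lambda>y. \<Sum>i\<in>Basis. ((y - c) \<bullet> i) * ((y - c) \<bullet> i))"
      by (intro Ck_on_sum Ck_on_mult lin) auto
    then have q: "Ck_on k UNIV (\<lambda>y. (y - c) \<bullet> (y - c))"
      by (simp add: euclidean_inner[symmetric])
    have "Ck_on k UNIV (\<lambda>y. flat_exp 0 ((y - c) \<bullet> (y - c) + (- b)))"
      by (rule Ck_on_compose[OF open_UNIV _ F]) (intro Ck_on_add Ck_on_const q open_UNIV subset_UNIV)+
    then have "Ck_on k UNIV (\<lambda>y. e + (- 1) * flat_exp 0 ((y - c) \<bullet> (y - c) + (- b)))"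
      by (intro Ck_on_add Ck_on_mult Ck_on_const open_UNIV)
    then have "Ck_on k UNIV (\<lambda>y. flat_exp 0 (e + (- 1) * flat_exp 0 ((y - c) \<bullet> (y - c) + (- b))))"
      by (rule Ck_on_compose[OF open_UNIV _ F]) simp
    then show ?thesis unfolding \<rho>_def by (intro Ck_on_mult Ck_on_const open_UNIV)
  qed
  then show "smooth_on UNIV \<rho>" by (simp add: smooth_on_def)
  show "0 < sqrt b" using b by simp
  show "\<rho> y = 1" if "y \<in> ball c (sqrt b)" for y
  proof -
    have "norm (y - c) < sqrt b" using that by (simp add: dist_norm norm_minus_commute)
    then have "(norm (y - c))\<^sup>2 < b" using real_less_rsqrt b
      by (metis norm_ge_zero real_sqrt_less_iff real_sqrt_unique)
    then have "(y - c) \<bullet> (y - c) < b" by (simp add: power2_norm_eq_inner)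
    then show ?thesis using e by (simp add: \<rho>_def flat_exp_def)
  qed
  show "\<rho> y = 0" if "y \<notin> cball c r" for y
  proof -
    have "r < norm (y - c)" using that by (simp add: dist_norm norm_minus_commute)
    then have "r\<^sup>2 < (norm (y - c))\<^sup>2" using assms by (intro power_strict_mono) auto
    then have "b < (y - c) \<bullet> (y - c) - b" by (simp add: power2_norm_eq_inner b_def)
    moreover from this have "inverse ((y - c) \<bullet> (y - c) - b) \<le> inverse b"
      using b by (intro le_imp_inverse_le) auto
    ultimately have "e \<le> flat_exp 0 ((y - c) \<bullet> (y - c) - b)"
      using b by (simp add: e_def flat_exp_def)
    then show ?thesis by (simp add: \<rho>_def flat_exp_def)
  qed
qed

lemma sum_fun_apply: "(\<Sum>i\<in>I. f i) x = (\<Sum>i\<in>I. f i x)"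
  by (induction I rule: infinite_finite_induct) auto

section \<open>Smooth functions on a manifold\<close>

locale smooth_manifold =
  fixes A :: "('m::t2_space, 'e::euclidean_space) chart set"
  assumes atlas: "smooth_atlas A"
begin

lemma chart_homeomorphism:
  assumes "(U, \<phi>) \<in> A"
  shows "open U" "open (\<phi> ` U)" "homeomorphism U (\<phi> ` U) \<phi> (inv_into U \<phi>)"
  using atlas assms unfolding smooth_atlas_def is_chart_def by auto

lemma inv_into_chart:
  assumes "(U, \<phi>) \<in> A" "p \<in> U"
  shows "inv_into U \<phi> (\<phi> p) = p"
  using chart_homeomorphism(3)[OF assms(1)] assms(2) by (simp add: homeomorphism_apply1)

lemma chart_at:
  obtains U \<phi> where "(U, \<phi>) \<in> A" "p \<in> U"
  using atlas unfolding smooth_atlas_def by blast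

lemma open_chart_image:
  assumes "(U, \<phi>) \<in> A" "open W"
  shows "open (\<phi> ` (U \<inter> W))"
proof -
  have "\<phi> ` (U \<inter> W) = \<phi> ` U \<inter> inv_into U \<phi> -` W"
    using inv_into_chart[OF assms(1)] by force
  moreover have "continuous_on (\<phi> ` U) (inv_into U \<phi>)"
    using chart_homeomorphism(3)[OF assms(1)] by (simp add: homeomorphism_def)
  ultimately show ?thesis
    using chart_homeomorphism(2)[OF assms(1)] assms(2) by (simp add: continuous_open_preimage)
qed

lemma smooth_fun_onD:
  "smooth_fun_on A W f \<Longrightarrow> (U, \<phi>) \<in> A \<Longrightarrow> smooth_on (\<phi> ` (U \<inter> W)) (f \<circ> inv_into U \<phi>)"
  unfolding smooth_fun_on_def by auto

lemma smooth_fun_onI: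
  "(\<And>U \<phi>. (U, \<phi>) \<in> A \<Longrightarrow> smooth_on (\<phi> ` (U \<inter> W)) (f \<circ> inv_into U \<phi>)) \<Longrightarrow> smooth_fun_on A W f"
  unfolding smooth_fun_on_def by auto

lemma smooth_fun_on_subset: "smooth_fun_on A W f \<Longrightarrow> V \<subseteq> W \<Longrightarrow> smooth_fun_on A V f"
  by (meson smooth_fun_onI smooth_fun_onD smooth_on_subset image_mono Int_mono subset_refl)

lemma smooth_fun_on_cong:
  assumes "smooth_fun_on A W f" "open W" "\<And>q. q \<in> W \<Longrightarrow> f q = g q"
  shows "smooth_fun_on A W g"
proof (rule smooth_fun_onI)
  fix U \<phi> assume c: "(U, \<phi>) \<in> A"
  show "smooth_on (\<phi> ` (U \<inter> W)) (g \<circ> inv_into U \<phi>)"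
    by (rule smooth_on_cong[OF smooth_fun_onD[OF assms(1) c] open_chart_image[OF c assms(2)]])
      (use inv_into_chart[OF c] assms(3) in auto)
qed

lemma smooth_fun_on_local:
  assumes "\<And>p. p \<in> W \<Longrightarrow> \<exists>N. open N \<and> p \<in> N \<and> smooth_fun_on A N f"
  shows "smooth_fun_on A W f"
proof (rule smooth_fun_onI, rule smooth_on_local)
  fix U \<phi> y assume c: "(U, \<phi>) \<in> A" and "y \<in> \<phi> ` (U \<inter> W)"
  then obtain p where p: "p \<in> U" "p \<in> W" "y = \<phi> p" by blast
  from assms[OF p(2)] obtain N where N: "open N" "p \<in> N" "smooth_fun_on A N f" by blast
  show "\<exists>T. open T \<and> y \<in> T \<and> smooth_on T (f \<circ> inv_into U \<phi>)"
    using open_chart_image[OF c N(1)] smooth_fun_onD[OF N(3) c] p N(2)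
    by (intro exI[of _ "\<phi> ` (U \<inter> N)"]) auto
qed

lemma smooth_fun_on_const: "smooth_fun_on A W (\<lambda>q. c)"
  by (rule smooth_fun_onI) (simp add: smooth_on_def o_def Ck_on_const)

lemma smooth_fun_on_add:
  assumes "open W" "smooth_fun_on A W f" "smooth_fun_on A W g"
  shows "smooth_fun_on A W (\<lambda>q. f q + g q)"
proof (rule smooth_fun_onI)
  fix U \<phi> assume c: "(U, \<phi>) \<in> A"
  show "smooth_on (\<phi> ` (U \<inter> W)) ((\<lambda>q. f q + g q) \<circ> inv_into U \<phi>)"
    using smooth_on_add[OF open_chart_image[OF c assms(1)] smooth_fun_onD[OF assms(2) c]
      smooth_fun_onD[OF assms(3) c]] by (simp add: o_def)
qed

lemma smooth_fun_on_mult: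
  assumes "open W" "smooth_fun_on A W f" "smooth_fun_on A W g"
  shows "smooth_fun_on A W (\<lambda>q. f q * g q)"
proof (rule smooth_fun_onI)
  fix U \<phi> assume c: "(U, \<phi>) \<in> A"
  show "smooth_on (\<phi> ` (U \<inter> W)) ((\<lambda>q. f q * g q) \<circ> inv_into U \<phi>)"
    using smooth_on_mult[OF open_chart_image[OF c assms(1)] smooth_fun_onD[OF assms(2) c]
      smooth_fun_onD[OF assms(3) c]] by (simp add: o_def)
qed

lemma smooth_fun_on_diff:
  assumes "open W" "smooth_fun_on A W f" "smooth_fun_on A W g"
  shows "smooth_fun_on A W (\<lambda>q. f q - g q)"
  using smooth_fun_on_add[OF assms(1,2) smooth_fun_on_mult[OF assms(1) smooth_fun_on_const[of _ "-1"] assms(3)]]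
  by simp

text \<open>In another chart \<psi> the function is \<open>g\<close> after the transition map from
  \<psi> to \<phi>; compatibility of the atlas makes that map smooth.\<close>

lemma smooth_fun_on_chart_comp:
  assumes c: "(U, \<phi>) \<in> A" and W: "open W" "W \<subseteq> U" and g: "smooth_on T g" "\<phi> ` W \<subseteq> T"
  shows "smooth_fun_on A W (\<lambda>q. g (\<phi> q))"
proof (rule smooth_fun_onI)
  fix V \<psi> assume c': "(V, \<psi>) \<in> A"
  have "smooth_on (\<psi> ` (V \<inter> U)) (\<phi> \<circ> inv_into V \<psi>)"
    using atlas c c' unfolding smooth_atlas_def by fast
  then have "smooth_on (\<psi> ` (V \<inter> W)) (\<phi> \<circ> inv_into V \<psi>)"
    by (rule smooth_on_subset) (use W in auto)
  from smooth_on_compose[OF open_chart_image[OF c' W(1)] this g(1)]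
  have "smooth_on (\<psi> ` (V \<inter> W)) (\<lambda>x. g ((\<phi> \<circ> inv_into V \<psi>) x))"
    using g(2) inv_into_chart[OF c'] by fastforce
  then show "smooth_on (\<psi> ` (V \<inter> W)) ((\<lambda>q. g (\<phi> q)) \<circ> inv_into V \<psi>)"
    by (simp add: o_def)
qed

lemma smooth_fun_on_coord:
  assumes "(U, \<phi>) \<in> A"
  shows "smooth_fun_on A U (\<lambda>q. \<phi> q \<bullet> i)"
proof (rule smooth_fun_on_chart_comp[OF assms, where T = UNIV and g = "\<lambda>y. y \<bullet> i"])
  show "smooth_on UNIV (\<lambda>y. y \<bullet> i)" for i :: 'e
    unfolding smooth_on_def
    by (auto intro: Ck_on_bounded_linear[OF open_UNIV bounded_linear_inner_left] Ck_on_id)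
qed (use chart_homeomorphism(1)[OF assms] in auto)

text \<open>Vanishing off a closed \<open>K\<close> inside \<open>W\<close> is stronger than
  vanishing off \<open>W\<close>: the open sets \<open>W\<close> and \<open>- K\<close> cover the
  manifold, so \<rho> times a function smooth only on \<open>W\<close> is smooth everywhere.\<close>

lemma smooth_bump:
  assumes "open W" "p \<in> W"
  obtains \<rho> N K where "smooth_fun_on A UNIV \<rho>" "open N" "p \<in> N" "N \<subseteq> W" "\<And>q. q \<in> N \<Longrightarrow> \<rho> q = 1"
    "closed K" "K \<subseteq> W" "\<And>q. q \<notin> K \<Longrightarrow> \<rho> q = 0"
proof -
  obtain U \<phi> where c: "(U, \<phi>) \<in> A" and "p \<in> U" by (rule chart_at)
  note h = chart_homeomorphism[OF c]
  have "\<phi> p \<in> \<phi> ` (U \<inter> W)" using \<open>p \<in> U\<close> assms by auto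
  then obtain r where r: "r > 0" "cball (\<phi> p) r \<subseteq> \<phi> ` (U \<inter> W)"
    using open_contains_cball open_chart_image[OF c assms(1)] by blast
  obtain g d where g: "smooth_on UNIV g" "0 < d" "\<And>y. y \<in> ball (\<phi> p) d \<Longrightarrow> g y = (1::real)"
    "\<And>y. y \<notin> cball (\<phi> p) r \<Longrightarrow> g y = 0"
    using smooth_bump_Euclidean[OF r(1)] by metis
  define K where "K = inv_into U \<phi> ` cball (\<phi> p) r"
  define \<rho> where "\<rho> q = (if q \<in> U then g (\<phi> q) else 0)" for q
  define N where "N = U \<inter> \<phi> -` ball (\<phi> p) d"
  have "continuous_on (cball (\<phi> p) r) (inv_into U \<phi>)"
    using h(3) r(2) by (auto simp: homeomorphism_def elim!: continuous_on_subset)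
  \<comment> \<open>\<open>K\<close> is a compact image, and compact sets are closed because the
    manifold is Hausdorff.\<close>
  then have K: "closed K"
    unfolding K_def by (intro compact_imp_closed compact_continuous_image) auto
  have KW: "K \<subseteq> U \<inter> W" using r(2) inv_into_chart[OF c] by (force simp: K_def)
  have zero: "\<rho> q = 0" if "q \<notin> K" for q
  proof (cases "q \<in> U")
    case True
    then have "\<phi> q \<notin> cball (\<phi> p) r"
      using that inv_into_chart[OF c True] by (metis K_def imageI)
    then show ?thesis using g(4) by (simp add: \<rho>_def)
  qed (simp add: \<rho>_def)
  have one: "\<rho> q = 1" if "q \<in> N" for q
    using that g(3) by (auto simp: \<rho>_def N_def)
  have "smooth_fun_on A UNIV \<rho>"
  proof (rule smooth_fun_on_local)
    fix q
    show "\<exists>N. open N \<and> q \<in> N \<and> smooth_fun_on A N \<rho>"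
    proof (cases "q \<in> U")
      case True
      have "smooth_fun_on A U (\<lambda>q. g (\<phi> q))"
        by (rule smooth_fun_on_chart_comp[OF c h(1) _ g(1)]) auto
      then have "smooth_fun_on A U \<rho>"
        by (rule smooth_fun_on_cong) (use h(1) in \<open>auto simp: \<rho>_def\<close>)
      then show ?thesis using True h(1) by blast
    next
      case False
      have "smooth_fun_on A (- K) \<rho>"
        by (rule smooth_fun_on_cong[OF smooth_fun_on_const[of _ 0]]) (use K zero in auto)
      then show ?thesis using False K KW by (intro exI[of _ "- K"]) auto
    qed
  qed
  moreover have "open N"
    unfolding N_def using h by (intro continuous_open_preimage) (auto simp: homeomorphism_def)
  moreover have "p \<in> N" using \<open>p \<in> U\<close> g(2) by (simp add: N_def)
  \<comment> \<open>On \<open>N\<close> the function \<rho> is 1, hence nonzero, so \<open>N\<close>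
    lies in \<open>K\<close>.\<close>
  moreover have "N \<subseteq> W" using zero one KW by force
  ultimately show ?thesis using that one zero K KW by blast
qed

lemma smooth_fun_bump_times:
  assumes "smooth_fun_on A UNIV \<rho>" "closed K" "K \<subseteq> W" "\<And>q. q \<notin> K \<Longrightarrow> \<rho> q = 0"
    and "open W" "smooth_fun_on A W g"
  shows "smooth_fun_on A UNIV (\<lambda>q. \<rho> q * g q)"
proof (rule smooth_fun_on_local)
  fix q
  show "\<exists>N. open N \<and> q \<in> N \<and> smooth_fun_on A N (\<lambda>q. \<rho> q * g q)"
  proof (cases "q \<in> W")
    case True
    have "smooth_fun_on A W (\<lambda>q. \<rho> q * g q)"
      using smooth_fun_on_mult[OF assms(5) smooth_fun_on_subset[OF assms(1)] assms(6)] by simp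
    then show ?thesis using True assms(5) by blast
  next
    case False
    have "smooth_fun_on A (- K) (\<lambda>q. \<rho> q * g q)"
      by (rule smooth_fun_on_cong[OF smooth_fun_on_const[of _ 0]]) (use assms(2,4) in auto)
    then show ?thesis using False assms(2,3) by (intro exI[of _ "- K"]) auto
  qed
qed

lemma smooth_fun_globalize:
  assumes "smooth_fun_on A W f" "open W" "p \<in> W"
  obtains F N where "smooth_fun_on A UNIV F" "open N" "p \<in> N" "N \<subseteq> W" "\<And>q. q \<in> N \<Longrightarrow> F q = f q"
proof -
  obtain \<rho> N K where b: "smooth_fun_on A UNIV \<rho>" "open N" "p \<in> N" "N \<subseteq> W"
    "\<And>q. q \<in> N \<Longrightarrow> \<rho> q = 1" "closed K" "K \<subseteq> W" "\<And>q. q \<notin> K \<Longrightarrow> \<rho> q = 0"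
    by (rule smooth_bump[OF assms(2,3)]) blast
  show ?thesis
    by (rule that[OF smooth_fun_bump_times[OF b(1,6,7,8) assms(2,1)] b(2,3,4)]) (use b(5) in auto)
qed

section \<open>Tangent and cotangent spaces\<close>

lemma smooth_near_cong:
  assumes "f \<in> smooth_near A p" "open N" "p \<in> N" "\<And>q. q \<in> N \<Longrightarrow> f q = g q"
  shows "g \<in> smooth_near A p"
proof -
  obtain W where W: "open W" "p \<in> W" "smooth_fun_on A W f"
    using assms(1) by (auto simp: smooth_near_def)
  have "smooth_fun_on A (W \<inter> N) g"
    by (rule smooth_fun_on_cong[OF smooth_fun_on_subset[OF W(3)]]) (use W assms in auto)
  then show ?thesis using W assms by (auto simp: smooth_near_def)
qed

lemma smooth_nearI: "smooth_fun_on A W f \<Longrightarrow> open W \<Longrightarrow> p \<in> W \<Longrightarrow> f \<in> smooth_near A p"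
  by (auto simp: smooth_near_def)

lemma smooth_near_const: "(\<lambda>q. c) \<in> smooth_near A p"
  by (rule smooth_nearI[OF smooth_fun_on_const open_UNIV UNIV_I])

lemma smooth_near_add:
  assumes "f \<in> smooth_near A p" "g \<in> smooth_near A p"
  shows "f + g \<in> smooth_near A p"
proof -
  obtain W V where "open W" "p \<in> W" "smooth_fun_on A W f" "open V" "p \<in> V" "smooth_fun_on A V g"
    using assms by (auto simp: smooth_near_def)
  then have "smooth_fun_on A (W \<inter> V) (\<lambda>q. f q + g q)"
    by (intro smooth_fun_on_add) (auto intro: smooth_fun_on_subset)
  then show ?thesis
    using \<open>open W\<close> \<open>open V\<close> \<open>p \<in> W\<close> \<open>p \<in> V\<close> by (auto simp: smooth_near_def plus_fun_def)
qed

lemma smooth_near_mult: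
  assumes "f \<in> smooth_near A p" "g \<in> smooth_near A p"
  shows "f * g \<in> smooth_near A p"
proof -
  obtain W V where "open W" "p \<in> W" "smooth_fun_on A W f" "open V" "p \<in> V" "smooth_fun_on A V g"
    using assms by (auto simp: smooth_near_def)
  then have "smooth_fun_on A (W \<inter> V) (\<lambda>q. f q * g q)"
    by (intro smooth_fun_on_mult) (auto intro: smooth_fun_on_subset)
  then show ?thesis
    using \<open>open W\<close> \<open>open V\<close> \<open>p \<in> W\<close> \<open>p \<in> V\<close> by (auto simp: smooth_near_def times_fun_def)
qed

lemma smooth_near_scale: "f \<in> smooth_near A p \<Longrightarrow> scale_fun r f \<in> smooth_near A p"
  using smooth_near_mult[OF smooth_near_const] by (simp add: scale_fun_def times_fun_def)

lemma smooth_near_sum: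
  "(\<And>i. i \<in> I \<Longrightarrow> f i \<in> smooth_near A p) \<Longrightarrow> (\<Sum>i\<in>I. f i) \<in> smooth_near A p"
  by (induction I rule: infinite_finite_induct)
    (auto intro: smooth_near_add smooth_near_const[of 0] simp: zero_fun_def)

lemma coord_smooth_near: "(U, \<phi>) \<in> A \<Longrightarrow> p \<in> U \<Longrightarrow> (\<lambda>q. \<phi> q \<bullet> i) \<in> smooth_near A p"
  using smooth_nearI[OF smooth_fun_on_coord] chart_homeomorphism(1) by blast

context
  fixes p v assumes v: "v \<in> tangent_space A p"
begin

lemma tangent_add: "f \<in> smooth_near A p \<Longrightarrow> g \<in> smooth_near A p \<Longrightarrow> v (f + g) = v f + v g"
  and tangent_scale: "f \<in> smooth_near A p \<Longrightarrow> v (scale_fun r f) = r * v f"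
  and tangent_mult: "f \<in> smooth_near A p \<Longrightarrow> g \<in> smooth_near A p \<Longrightarrow>
    v (f * g) = f p * v g + g p * v f"
  and tangent_outside: "f \<notin> smooth_near A p \<Longrightarrow> v f = 0"
  using v by (auto simp: tangent_space_def linear_fun_on_def)

lemma tangent_const: "v (\<lambda>q. c) = 0"
proof -
  have "v ((\<lambda>q. 1) * (\<lambda>q. 1)) = 0"
    using tangent_mult[OF smooth_near_const smooth_near_const, of 1 1] by (simp add: times_fun_def)
  then show ?thesis
    using tangent_scale[OF smooth_near_const, of c 1] by (simp add: scale_fun_def times_fun_def)
qed

lemma tangent_sum:
  "(\<And>i. i \<in> I \<Longrightarrow> f i \<in> smooth_near A p) \<Longrightarrow> v (\<Sum>i\<in>I. f i) = (\<Sum>i\<in>I. v (f i))"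
  by (induction I rule: infinite_finite_induct)
    (auto simp: tangent_add smooth_near_sum zero_fun_def tangent_const[of 0])

lemma tangent_cong:
  assumes f: "f \<in> smooth_near A p" and N: "open N" "p \<in> N" and eq: "\<And>q. q \<in> N \<Longrightarrow> f q = g q"
  shows "v f = v g"
proof -
  define u :: "'m \<Rightarrow> real" where "u q = (if q \<in> N then 0 else 1)" for q
  have g: "g \<in> smooth_near A p" by (rule smooth_near_cong[OF assms])
  have u: "u \<in> smooth_near A p"
    by (rule smooth_near_cong[OF smooth_near_const[of 0] N]) (simp add: u_def)
  let ?d = "f + scale_fun (- 1) g"
  have d: "?d \<in> smooth_near A p" using f g by (intro smooth_near_add smooth_near_scale)
  have "v ?d = v (u * ?d)"
    by (rule arg_cong[of _ _ v]) (auto simp: fun_eq_iff u_def scale_fun_def eq)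
  also have "\<dots> = 0"
    using tangent_mult[OF u d] N eq[OF N(2)] by (simp add: u_def scale_fun_def)
  finally show ?thesis
    using tangent_add[OF f smooth_near_scale[OF g], of "- 1"] tangent_scale[OF g, of "- 1"] by simp
qed

text \<open>Hadamard's lemma writes \<open>f\<close> near \<open>p\<close> as \<open>f p\<close>
  plus a sum of products \<open>x i * G' i\<close>, where the shifted coordinate \<open>x i\<close>
  vanishes at \<open>p\<close>. The product rule keeps only \<open>v (x i)\<close> times the value
  of \<open>G' i\<close> at \<open>p\<close>, which is a partial derivative of
  \<open>f\<close>.\<close>

lemma tangent_in_coordinates:
  assumes c: "(U, \<phi>) \<in> A" and p: "p \<in> U" and f: "f \<in> smooth_near A p"
  shows "v f = (\<Sum>i\<in>Basis. v (\<lambda>q. \<phi> q \<bullet> i) * frechet_derivative (f \<circ> inv_into U \<phi>) (at (\<phi> p)) i)"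
proof -
  obtain W where W: "open W" "p \<in> W" "smooth_fun_on A W f"
    using f by (auto simp: smooth_near_def)
  have "\<phi> p \<in> \<phi> ` (U \<inter> W)" using p W by auto
  then obtain r where r: "r > 0" "ball (\<phi> p) r \<subseteq> \<phi> ` (U \<inter> W)"
    using open_contains_ball open_chart_image[OF c W(1)] by blast
  have "smooth_on (ball (\<phi> p) r) (f \<circ> inv_into U \<phi>)"
    using smooth_on_subset[OF smooth_fun_onD[OF W(3) c] r(2)] .
  then obtain G where G: "\<And>i. smooth_on (ball (\<phi> p) r) (G i)"
    "\<And>y. y \<in> ball (\<phi> p) r \<Longrightarrow> (f \<circ> inv_into U \<phi>) y
        = (f \<circ> inv_into U \<phi>) (\<phi> p) + (\<Sum>i\<in>Basis. ((y - \<phi> p) \<bullet> i) * G i y)"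
    "\<And>i. G i (\<phi> p) = frechet_derivative (f \<circ> inv_into U \<phi>) (at (\<phi> p)) i"
    using Hadamard r(1) by blast
  define N where "N = U \<inter> \<phi> -` ball (\<phi> p) r"
  have N: "open N" "p \<in> N" "N \<subseteq> U"
    unfolding N_def using chart_homeomorphism[OF c] p r(1)
    by (auto intro!: continuous_open_preimage simp: homeomorphism_def)
  define x where "x i = (\<lambda>q. \<phi> q \<bullet> i) + (\<lambda>q. - (\<phi> p \<bullet> i))" for i
  define G' where "G' i = (\<lambda>q. G i (\<phi> q))" for i
  have x: "x i \<in> smooth_near A p" for i
    unfolding x_def by (intro smooth_near_add smooth_near_const coord_smooth_near[OF c p])
  have G': "G' i \<in> smooth_near A p" for i
    unfolding G'_def
    by (rule smooth_nearI[OF smooth_fun_on_chart_comp[OF c N(1,3) G(1)] N(1,2)]) (auto simp: N_def)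
  have vx: "v (x i) = v (\<lambda>q. \<phi> q \<bullet> i)" for i
    using tangent_add[OF coord_smooth_near[OF c p, of i] smooth_near_const] tangent_const
    by (simp add: x_def)
  have "v f = v ((\<lambda>q. f p) + (\<Sum>i\<in>Basis. x i * G' i))"
  proof (rule tangent_cong[OF f N(1,2)])
    fix q assume "q \<in> N"
    then show "f q = ((\<lambda>q. f p) + (\<Sum>i\<in>Basis. x i * G' i)) q"
      using G(2)[of "\<phi> q"] inv_into_chart[OF c] p
      by (simp add: N_def x_def G'_def sum_fun_apply inner_diff_left)
  qed
  also have "\<dots> = (\<Sum>i\<in>Basis. v (x i * G' i))"
    using x G' by (simp add: tangent_add tangent_sum tangent_const smooth_near_const
        smooth_near_sum smooth_near_mult)
  also have "\<dots> = (\<Sum>i\<in>Basis. v (\<lambda>q. \<phi> q \<bullet> i) * frechet_derivative (f \<circ> inv_into U \<phi>) (at (\<phi> p)) i)"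
  proof (rule sum.cong[OF refl])
    fix i
    have "x i p = 0" "G' i p = frechet_derivative (f \<circ> inv_into U \<phi>) (at (\<phi> p)) i"
      using G(3) by (simp_all add: x_def G'_def)
    then show "v (x i * G' i)
        = v (\<lambda>q. \<phi> q \<bullet> i) * frechet_derivative (f \<circ> inv_into U \<phi>) (at (\<phi> p)) i"
      by (simp add: tangent_mult[OF x G'] vx)
  qed
  finally show ?thesis .
qed

end

lemma tangent_zero: "0 \<in> tangent_space A p"
  by (simp add: tangent_space_def linear_fun_on_def)

lemma tangent_space_add:
  "v \<in> tangent_space A p \<Longrightarrow> w \<in> tangent_space A p \<Longrightarrow> v + w \<in> tangent_space A p"
  by (simp add: tangent_space_def linear_fun_on_def algebra_simps)

lemma tangent_space_scale: "v \<in> tangent_space A p \<Longrightarrow> scale_fun r v \<in> tangent_space A p"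
  by (simp add: tangent_space_def linear_fun_on_def scale_fun_def algebra_simps)

lemma tangent_space_sum:
  "(\<And>i. i \<in> I \<Longrightarrow> v i \<in> tangent_space A p) \<Longrightarrow> (\<Sum>i\<in>I. v i) \<in> tangent_space A p"
  by (induction I rule: infinite_finite_induct) (auto intro: tangent_space_add tangent_zero)

text \<open>The partial derivative along the \<open>i\<close>-th coordinate; the default 0 is the
  normalisation demanded by \<open>tangent_space\<close>.\<close>

definition coord_vec :: "'m set \<Rightarrow> ('m \<Rightarrow> 'e) \<Rightarrow> 'e \<Rightarrow> 'm \<Rightarrow> 'm tvec" where
  "coord_vec U \<phi> i p = (\<lambda>f. if f \<in> smooth_near A p
     then frechet_derivative (f \<circ> inv_into U \<phi>) (at (\<phi> p)) i else 0)"

lemma coord_vec_tangent: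
  assumes c: "(U, \<phi>) \<in> A" and p: "p \<in> U"
  shows "coord_vec U \<phi> i p \<in> tangent_space A p"
proof -
  have d: "(f \<circ> inv_into U \<phi> has_derivative frechet_derivative (f \<circ> inv_into U \<phi>) (at (\<phi> p))) (at (\<phi> p))"
    if f: "f \<in> smooth_near A p" for f
  proof -
    obtain W where W: "open W" "p \<in> W" "smooth_fun_on A W f"
      using f by (auto simp: smooth_near_def)
    show ?thesis by (rule smooth_on_has_derivative[OF smooth_fun_onD[OF W(3) c]]) (use W p in auto)
  qed
  have add: "frechet_derivative ((f + g) \<circ> inv_into U \<phi>) (at (\<phi> p)) i
      = frechet_derivative (f \<circ> inv_into U \<phi>) (at (\<phi> p)) i
      + frechet_derivative (g \<circ> inv_into U \<phi>) (at (\<phi> p)) i"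
    if "f \<in> smooth_near A p" "g \<in> smooth_near A p" for f g
    using frechet_derivative_at[OF has_derivative_add[OF d[OF that(1)] d[OF that(2)]], symmetric]
    by (simp add: o_def)
  have scale: "frechet_derivative (scale_fun r f \<circ> inv_into U \<phi>) (at (\<phi> p)) i
      = r * frechet_derivative (f \<circ> inv_into U \<phi>) (at (\<phi> p)) i"
    if "f \<in> smooth_near A p" for f r
    using frechet_derivative_at[OF has_derivative_mult_right[OF d[OF that], of r], symmetric]
    by (simp add: o_def scale_fun_def)
  have mult: "frechet_derivative ((f * g) \<circ> inv_into U \<phi>) (at (\<phi> p)) i
      = f p * frechet_derivative (g \<circ> inv_into U \<phi>) (at (\<phi> p)) i
      + g p * frechet_derivative (f \<circ> inv_into U \<phi>) (at (\<phi> p)) i"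
    if "f \<in> smooth_near A p" "g \<in> smooth_near A p" for f g
    using frechet_derivative_at[OF has_derivative_mult[OF d[OF that(1)] d[OF that(2)]], symmetric]
    by (simp add: o_def inv_into_chart[OF c p])
  show ?thesis
    unfolding tangent_space_def linear_fun_on_def
    by (auto simp: coord_vec_def smooth_near_add smooth_near_scale smooth_near_mult add scale mult)
qed

lemma tangent_eq_coord_vec_sum:
  assumes "v \<in> tangent_space A p" "(U, \<phi>) \<in> A" "p \<in> U"
  shows "v = (\<Sum>i\<in>Basis. scale_fun (v (\<lambda>q. \<phi> q \<bullet> i)) (coord_vec U \<phi> i p))"
proof
  fix f
  show "v f = (\<Sum>i\<in>Basis. scale_fun (v (\<lambda>q. \<phi> q \<bullet> i)) (coord_vec U \<phi> i p)) f"
    using tangent_in_coordinates[OF assms] tangent_outside[OF assms(1)]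
    by (cases "f \<in> smooth_near A p") (auto simp: sum_fun_apply scale_fun_def coord_vec_def)
qed

context
  fixes p a assumes a: "a \<in> cotangent_space A p"
begin

lemma cotangent_add: "v \<in> tangent_space A p \<Longrightarrow> w \<in> tangent_space A p \<Longrightarrow> a (v + w) = a v + a w"
  and cotangent_scale: "v \<in> tangent_space A p \<Longrightarrow> a (scale_fun r v) = r * a v"
  and cotangent_outside: "v \<notin> tangent_space A p \<Longrightarrow> a v = 0"
  using a by (auto simp: cotangent_space_def linear_fun_on_def)

lemma cotangent_zero: "a 0 = 0"
  using cotangent_scale[OF tangent_zero, of 0] by (simp add: scale_fun_def zero_fun_def)

lemma cotangent_sum:
  "(\<And>i. i \<in> I \<Longrightarrow> v i \<in> tangent_space A p) \<Longrightarrow> a (\<Sum>i\<in>I. v i) = (\<Sum>i\<in>I. a (v i))"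
  by (induction I rule: infinite_finite_induct)
    (auto simp: cotangent_add cotangent_zero tangent_space_sum)

lemma cotangent_in_coordinates:
  assumes "v \<in> tangent_space A p" and c: "(U, \<phi>) \<in> A" and p: "p \<in> U"
  shows "a v = (\<Sum>i\<in>Basis. v (\<lambda>q. \<phi> q \<bullet> i) * a (coord_vec U \<phi> i p))"
proof -
  have "a v = a (\<Sum>i\<in>Basis. scale_fun (v (\<lambda>q. \<phi> q \<bullet> i)) (coord_vec U \<phi> i p))"
    using tangent_eq_coord_vec_sum[OF assms] by simp
  also have "\<dots> = (\<Sum>i\<in>Basis. v (\<lambda>q. \<phi> q \<bullet> i) * a (coord_vec U \<phi> i p))"
    using coord_vec_tangent[OF c p] by (simp add: cotangent_sum cotangent_scale tangent_space_scale)
  finally show ?thesis .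
qed

end

lemma cotangent_space_zero: "0 \<in> cotangent_space A p"
  by (simp add: cotangent_space_def linear_fun_on_def)

lemma cotangent_space_add:
  "a \<in> cotangent_space A p \<Longrightarrow> b \<in> cotangent_space A p \<Longrightarrow> a + b \<in> cotangent_space A p"
  by (simp add: cotangent_space_def linear_fun_on_def algebra_simps)

lemma cotangent_space_scale: "a \<in> cotangent_space A p \<Longrightarrow> scale_fun r a \<in> cotangent_space A p"
  by (simp add: cotangent_space_def linear_fun_on_def scale_fun_def algebra_simps)

end

section \<open>Vector fields and one-forms\<close>

definition fun_times_form :: "('m \<Rightarrow> real) \<Rightarrow> 'm oneform \<Rightarrow> 'm oneform" where
  "fun_times_form f \<alpha> = (\<lambda>p. scale_fun (f p) (\<alpha> p))"

lemma scale_fun_apply: "scale_fun r u z = r * u z"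
  by (simp add: scale_fun_def)

context smooth_manifold
begin

abbreviation "VF \<equiv> vector_fields A"
abbreviation "Om \<equiv> one_forms A"

lemma VF_tangent: "X \<in> VF \<Longrightarrow> X p \<in> tangent_space A p"
  and VF_smooth: "X \<in> VF \<Longrightarrow> open W \<Longrightarrow> smooth_fun_on A W f \<Longrightarrow> smooth_fun_on A W (apply_field X f)"
  by (auto simp: vector_fields_def)

lemma Om_cotangent: "\<alpha> \<in> Om \<Longrightarrow> \<alpha> p \<in> cotangent_space A p"
  and Om_smooth: "\<alpha> \<in> Om \<Longrightarrow> X \<in> VF \<Longrightarrow> smooth_fun_on A UNIV (pairing \<alpha> X)"
  by (auto simp: one_forms_def)

lemma VF_add: "X \<in> VF \<Longrightarrow> Y \<in> VF \<Longrightarrow> X + Y \<in> VF"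
  using smooth_fun_on_add
  by (auto simp: vector_fields_def tangent_space_add apply_field_def)

lemma VF_times: "smooth_fun_on A UNIV f \<Longrightarrow> X \<in> VF \<Longrightarrow> fun_times_field f X \<in> VF"
  using smooth_fun_on_mult smooth_fun_on_subset[of UNIV f]
  by (auto simp: vector_fields_def tangent_space_scale apply_field_def fun_times_field_def scale_fun_apply)

lemma VF_zero: "0 \<in> VF"
  using smooth_fun_on_const[of _ 0] by (auto simp: vector_fields_def tangent_zero apply_field_def)

lemma VF_sum: "(\<And>i. i \<in> I \<Longrightarrow> X i \<in> VF) \<Longrightarrow> (\<Sum>i\<in>I. X i) \<in> VF"
  by (induction I rule: infinite_finite_induct) (auto intro: VF_add VF_zero)

lemma Om_add: "\<alpha> \<in> Om \<Longrightarrow> \<beta> \<in> Om \<Longrightarrow> \<alpha> + \<beta> \<in> Om"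
  using smooth_fun_on_add
  by (auto simp: one_forms_def cotangent_space_add pairing_def)

lemma Om_times: "smooth_fun_on A UNIV f \<Longrightarrow> \<alpha> \<in> Om \<Longrightarrow> fun_times_form f \<alpha> \<in> Om"
  using smooth_fun_on_mult[of UNIV f]
  by (auto simp: one_forms_def cotangent_space_scale pairing_def fun_times_form_def scale_fun_apply)

lemma Om_zero: "0 \<in> Om"
  using smooth_fun_on_const[of _ 0] by (auto simp: one_forms_def cotangent_space_zero pairing_def)

lemma Om_sum: "(\<And>i. i \<in> I \<Longrightarrow> \<alpha> i \<in> Om) \<Longrightarrow> (\<Sum>i\<in>I. \<alpha> i) \<in> Om"
  by (induction I rule: infinite_finite_induct) (auto intro: Om_add Om_zero)

text \<open>Connections and one-forms are defined on global fields, so a coordinate frame must be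
  cut off before it can be used. The value 1 is recorded at \<open>p\<close> alone, because the
  frames serve only for evaluations at that point.\<close>

definition bump_chart :: "'m \<Rightarrow> 'm set \<Rightarrow> ('m \<Rightarrow> 'e) \<Rightarrow> ('m \<Rightarrow> real) \<Rightarrow> bool" where
  "bump_chart p U \<phi> \<rho> \<longleftrightarrow> (U, \<phi>) \<in> A \<and> p \<in> U \<and> smooth_fun_on A UNIV \<rho> \<and> \<rho> p = 1 \<and>
     (\<exists>K. closed K \<and> K \<subseteq> U \<and> (\<forall>q. q \<notin> K \<longrightarrow> \<rho> q = 0))"

lemma bump_chart_exists: obtains U \<phi> \<rho> where "bump_chart p U \<phi> \<rho>"
proof -
  obtain U \<phi> where c: "(U, \<phi>) \<in> A" "p \<in> U" by (rule chart_at)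
  show ?thesis
    by (rule smooth_bump[OF chart_homeomorphism(1)[OF c(1)] c(2)])
      (rule that, use c in \<open>auto simp: bump_chart_def\<close>)
qed

text \<open>Outside \<open>U\<close> the coordinate expressions carry no meaning; there the factor
  \<rho> is 0. The same holds for \<open>frame_form\<close>, which is \<rho> times a coordinate
  differential.\<close>

definition frame_field :: "('m \<Rightarrow> real) \<Rightarrow> 'm set \<Rightarrow> ('m \<Rightarrow> 'e) \<Rightarrow> 'e \<Rightarrow> 'm vfield" where
  "frame_field \<rho> U \<phi> i = (\<lambda>q. scale_fun (\<rho> q) (coord_vec U \<phi> i q))"

definition frame_form :: "('m \<Rightarrow> real) \<Rightarrow> ('m \<Rightarrow> 'e) \<Rightarrow> 'e \<Rightarrow> 'm oneform" where
  "frame_form \<rho> \<phi> i = (\<lambda>q v. if v \<in> tangent_space A q then \<rho> q * v (\<lambda>q. \<phi> q \<bullet> i) else 0)"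

context
  fixes p U \<phi> \<rho> assumes b: "bump_chart p U \<phi> \<rho>"
begin

lemma
  shows bump_chart: "(U, \<phi>) \<in> A" and bump_smooth: "smooth_fun_on A UNIV \<rho>"
    and bump_centre: "p \<in> U" "\<rho> p = 1"
  using b by (auto simp: bump_chart_def)

lemma bump_outside: "q \<notin> U \<Longrightarrow> \<rho> q = 0"
  using b by (auto simp: bump_chart_def)

lemma bump_times_smooth: "smooth_fun_on A U g \<Longrightarrow> smooth_fun_on A UNIV (\<lambda>q. \<rho> q * g q)"
  using b chart_homeomorphism(1)[OF bump_chart] unfolding bump_chart_def
  by (blast intro: smooth_fun_bump_times)

lemma bump_coord_smooth:
  assumes "X \<in> VF"
  shows "smooth_fun_on A UNIV (\<lambda>q. \<rho> q * X q (\<lambda>q. \<phi> q \<bullet> i))"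
  using bump_times_smooth VF_smooth[OF assms chart_homeomorphism(1) smooth_fun_on_coord] bump_chart
  unfolding apply_field_def by blast

lemma frame_field_VF: "frame_field \<rho> U \<phi> i \<in> VF"
proof -
  have t: "frame_field \<rho> U \<phi> i q \<in> tangent_space A q" for q
  proof (cases "q \<in> U")
    case True
    then show ?thesis
      using coord_vec_tangent[OF bump_chart] by (simp add: frame_field_def tangent_space_scale)
  next
    case False
    then have "frame_field \<rho> U \<phi> i q = 0"
      by (simp add: frame_field_def bump_outside scale_fun_def zero_fun_def)
    then show ?thesis by (simp add: tangent_zero)
  qed
  obtain K where K: "closed K" "K \<subseteq> U" "\<And>q. q \<notin> K \<Longrightarrow> \<rho> q = 0"
    using b by (auto simp: bump_chart_def)
  note c = bump_chart and U = chart_homeomorphism(1)[OF bump_chart]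
  have "smooth_fun_on A W (apply_field (frame_field \<rho> U \<phi> i) f)"
    if W: "open W" and f: "smooth_fun_on A W f" for W f
  proof (rule smooth_fun_on_local)
    fix q assume q: "q \<in> W"
    show "\<exists>N. open N \<and> q \<in> N \<and> smooth_fun_on A N (apply_field (frame_field \<rho> U \<phi> i) f)"
    proof (cases "q \<in> U")
      case True
      have "smooth_fun_on A (U \<inter> W) (\<lambda>q. frechet_derivative (f \<circ> inv_into U \<phi>) (at (\<phi> q)) i)"
        using smooth_on_frechet_derivative[OF smooth_fun_onD[OF f c], of i]
        by (rule smooth_fun_on_chart_comp[OF c, rotated 2]) (use U W in auto)
      then have "smooth_fun_on A (U \<inter> W)
          (\<lambda>q. \<rho> q * frechet_derivative (f \<circ> inv_into U \<phi>) (at (\<phi> q)) i)"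
        using U W by (intro smooth_fun_on_mult smooth_fun_on_subset[OF bump_smooth]) auto
      then have "smooth_fun_on A (U \<inter> W) (apply_field (frame_field \<rho> U \<phi> i) f)"
        by (rule smooth_fun_on_cong)
          (use U W smooth_nearI[OF f W] in \<open>auto simp: apply_field_def frame_field_def scale_fun_def coord_vec_def\<close>)
      then show ?thesis using U W q True by blast
    next
      case False
      have "smooth_fun_on A (- K) (apply_field (frame_field \<rho> U \<phi> i) f)"
        by (rule smooth_fun_on_cong[OF smooth_fun_on_const[of _ 0]])
          (use K in \<open>auto simp: apply_field_def frame_field_def scale_fun_def\<close>)
      then show ?thesis using False K by (intro exI[of _ "- K"]) auto
    qed
  qed
  with t show ?thesis by (simp add: vector_fields_def)
qed

lemma frame_form_Om: "frame_form \<rho> \<phi> i \<in> Om"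
proof -
  have "frame_form \<rho> \<phi> i q \<in> cotangent_space A q" for q
    by (auto simp: cotangent_space_def frame_form_def linear_fun_on_def tangent_space_add
        tangent_space_scale algebra_simps scale_fun_apply)
  moreover have "pairing (frame_form \<rho> \<phi> i) X = (\<lambda>q. \<rho> q * X q (\<lambda>q. \<phi> q \<bullet> i))" if "X \<in> VF" for X
    using VF_tangent[OF that] by (simp add: pairing_def frame_form_def)
  ultimately show ?thesis using bump_coord_smooth by (simp add: one_forms_def)
qed

text \<open>One factor \<open>\<rho>\<close> extends the coefficients by zero and the other one the coordinate frame.\<close>

lemma field_in_frame:
  assumes "X \<in> VF"
  shows "fun_times_field (\<lambda>q. \<rho> q * \<rho> q) X =
    (\<Sum>i\<in>Basis. fun_times_field (\<lambda>q. \<rho> q * X q (\<lambda>q. \<phi> q \<bullet> i)) (frame_field \<rho> U \<phi> i))"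
proof
  fix q
  show "fun_times_field (\<lambda>q. \<rho> q * \<rho> q) X q =
    (\<Sum>i\<in>Basis. fun_times_field (\<lambda>q. \<rho> q * X q (\<lambda>q. \<phi> q \<bullet> i)) (frame_field \<rho> U \<phi> i)) q"
  proof (cases "q \<in> U")
    case True
    show ?thesis
    proof
      fix f
      have "(\<Sum>i\<in>Basis. fun_times_field (\<lambda>q. \<rho> q * X q (\<lambda>q. \<phi> q \<bullet> i)) (frame_field \<rho> U \<phi> i)) q f
        = \<rho> q * \<rho> q * (\<Sum>i\<in>Basis. X q (\<lambda>q. \<phi> q \<bullet> i) * coord_vec U \<phi> i q f)"
        by (simp add: sum_fun_apply fun_times_field_def frame_field_def scale_fun_def
            sum_distrib_left mult.assoc mult.left_commute mult.commute)
      also have "\<dots> = \<rho> q * \<rho> q * X q f"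
        using fun_cong[OF tangent_eq_coord_vec_sum[OF VF_tangent[OF assms] bump_chart True], of f]
        by (simp only: sum_fun_apply scale_fun_def)
      finally show "fun_times_field (\<lambda>q. \<rho> q * \<rho> q) X q f =
        (\<Sum>i\<in>Basis. fun_times_field (\<lambda>q. \<rho> q * X q (\<lambda>q. \<phi> q \<bullet> i)) (frame_field \<rho> U \<phi> i)) q f"
        by (simp add: fun_times_field_def scale_fun_def)
    qed
  next
    case False
    then show ?thesis
      by (simp add: fun_times_field_def sum_fun_apply fun_eq_iff scale_fun_def frame_field_def bump_outside)
  qed
qed

lemma form_in_frame:
  assumes "\<alpha> \<in> Om"
  shows "fun_times_form (\<lambda>q. \<rho> q * \<rho> q) \<alpha> =
    (\<Sum>i\<in>Basis. fun_times_form (pairing \<alpha> (frame_field \<rho> U \<phi> i)) (frame_form \<rho> \<phi> i))"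
proof (intro ext)
  fix q v
  show "fun_times_form (\<lambda>q. \<rho> q * \<rho> q) \<alpha> q v =
    (\<Sum>i\<in>Basis. fun_times_form (pairing \<alpha> (frame_field \<rho> U \<phi> i)) (frame_form \<rho> \<phi> i)) q v"
  proof (cases "q \<in> U \<and> v \<in> tangent_space A q")
    case True
    then have q: "q \<in> U" and v: "v \<in> tangent_space A q" by auto
    have "\<alpha> q (frame_field \<rho> U \<phi> i q) = \<rho> q * \<alpha> q (coord_vec U \<phi> i q)" for i
      unfolding frame_field_def
      by (rule cotangent_scale[OF Om_cotangent[OF assms] coord_vec_tangent[OF bump_chart q]])
    then have "(\<Sum>i\<in>Basis. fun_times_form (pairing \<alpha> (frame_field \<rho> U \<phi> i)) (frame_form \<rho> \<phi> i)) q v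
      = (\<Sum>i\<in>Basis. (\<rho> q * \<alpha> q (coord_vec U \<phi> i q)) * (\<rho> q * v (\<lambda>q. \<phi> q \<bullet> i)))"
      using v by (simp add: sum_fun_apply fun_times_form_def pairing_def scale_fun_apply
          frame_form_def)
    also have "\<dots> = \<rho> q * \<rho> q * (\<Sum>i\<in>Basis. v (\<lambda>q. \<phi> q \<bullet> i) * \<alpha> q (coord_vec U \<phi> i q))"
      by (simp add: sum_distrib_left mult.assoc mult.left_commute mult.commute)
    also have "\<dots> = fun_times_form (\<lambda>q. \<rho> q * \<rho> q) \<alpha> q v"
      using cotangent_in_coordinates[OF Om_cotangent[OF assms] v bump_chart q]
      by (simp add: fun_times_form_def scale_fun_def)
    finally show ?thesis by simp
  next
    case False
    then show ?thesis
      using cotangent_outside[OF Om_cotangent[OF assms]]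
      by (cases "q \<in> U"; cases "v \<in> tangent_space A q")
        (simp_all add: fun_times_form_def sum_fun_apply scale_fun_apply frame_form_def bump_outside)
  qed
qed

end

section \<open>Extension of vectors and covectors to global fields, and tensoriality\<close>

lemma tangent_extend:
  assumes "v \<in> tangent_space A p"
  obtains X where "X \<in> VF" "X p = v"
proof -
  obtain U \<phi> \<rho> where b: "bump_chart p U \<phi> \<rho>" by (rule bump_chart_exists)
  define X where "X = (\<Sum>i\<in>Basis. fun_times_field (\<lambda>q. v (\<lambda>q. \<phi> q \<bullet> i)) (frame_field \<rho> U \<phi> i))"
  show ?thesis
  proof
    show "X \<in> VF" unfolding X_def
      by (intro VF_sum VF_times smooth_fun_on_const frame_field_VF[OF b])
    show "X p = v"
      using tangent_eq_coord_vec_sum[OF assms bump_chart[OF b] bump_centre(1)[OF b]] bump_centre(2)[OF b]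
      by (simp add: X_def sum_fun_apply fun_times_field_def frame_field_def)
  qed
qed

lemma cotangent_extend:
  assumes "a \<in> cotangent_space A p"
  obtains \<alpha> where "\<alpha> \<in> Om" "\<alpha> p = a"
proof -
  obtain U \<phi> \<rho> where b: "bump_chart p U \<phi> \<rho>" by (rule bump_chart_exists)
  define \<alpha> where "\<alpha> = (\<Sum>i\<in>Basis. fun_times_form (\<lambda>q. a (coord_vec U \<phi> i p)) (frame_form \<rho> \<phi> i))"
  show ?thesis
  proof
    show "\<alpha> \<in> Om" unfolding \<alpha>_def
      by (intro Om_sum Om_times smooth_fun_on_const frame_form_Om[OF b])
    have "\<alpha> p v = a v" for v
      using cotangent_in_coordinates[OF assms _ bump_chart[OF b] bump_centre(1)[OF b], of v]
        cotangent_outside[OF assms, of v] bump_centre(2)[OF b]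
      by (cases "v \<in> tangent_space A p")
        (simp_all add: \<alpha>_def sum_fun_apply fun_times_form_def frame_form_def scale_fun_apply mult.commute)
    then show "\<alpha> p = a" by blast
  qed
qed

text \<open>Since \<open>\<rho> p = 1\<close>, linearity over functions gives
  \<open>F X = F (\<rho>\<^sup>2 X)\<close>. The field on the right is a combination of global frame
  fields whose coefficients vanish at \<open>p\<close> together with \<open>X\<close>.\<close>

lemma field_tensorial:
  fixes F :: "'m vfield \<Rightarrow> real"
  assumes add: "\<And>X Y. X \<in> VF \<Longrightarrow> Y \<in> VF \<Longrightarrow> F (X + Y) = F X + F Y"
    and times: "\<And>f X. smooth_fun_on A UNIV f \<Longrightarrow> X \<in> VF \<Longrightarrow> F (fun_times_field f X) = f p * F X"
    and X: "X \<in> VF" "X p = 0"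
  shows "F X = 0"
proof -
  obtain U \<phi> \<rho> where b: "bump_chart p U \<phi> \<rho>" by (rule bump_chart_exists)
  have zero: "F 0 = 0" using add[OF VF_zero VF_zero] by simp
  have sum: "(\<And>i. i \<in> I \<Longrightarrow> Y i \<in> VF) \<Longrightarrow> F (\<Sum>i\<in>I. Y i) = (\<Sum>i\<in>I. F (Y i))" for I :: "'e set" and Y
    by (induction I rule: infinite_finite_induct) (auto simp: add zero VF_sum)
  have "F X = F (fun_times_field (\<lambda>q. \<rho> q * \<rho> q) X)"
    using times[OF smooth_fun_on_mult[OF open_UNIV bump_smooth[OF b] bump_smooth[OF b]] X(1)]
      bump_centre[OF b] by simp
  also have "\<dots> = (\<Sum>i\<in>Basis. (\<rho> p * X p (\<lambda>q. \<phi> q \<bullet> i)) * F (frame_field \<rho> U \<phi> i))"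
    unfolding field_in_frame[OF b X(1)]
    by (simp add: sum times VF_times bump_coord_smooth[OF b X(1)] frame_field_VF[OF b])
  also have "\<dots> = 0" using X(2) by simp
  finally show ?thesis .
qed

lemma form_tensorial:
  fixes F :: "'m oneform \<Rightarrow> real"
  assumes add: "\<And>\<alpha> \<beta>. \<alpha> \<in> Om \<Longrightarrow> \<beta> \<in> Om \<Longrightarrow> F (\<alpha> + \<beta>) = F \<alpha> + F \<beta>"
    and times: "\<And>f \<alpha>. smooth_fun_on A UNIV f \<Longrightarrow> \<alpha> \<in> Om \<Longrightarrow> F (fun_times_form f \<alpha>) = f p * F \<alpha>"
    and \<alpha>: "\<alpha> \<in> Om" "\<alpha> p = 0"
  shows "F \<alpha> = 0"
proof -
  obtain U \<phi> \<rho> where b: "bump_chart p U \<phi> \<rho>" by (rule bump_chart_exists)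
  have zero: "F 0 = 0" using add[OF Om_zero Om_zero] by simp
  have sum: "(\<And>i. i \<in> I \<Longrightarrow> \<beta> i \<in> Om) \<Longrightarrow> F (\<Sum>i\<in>I. \<beta> i) = (\<Sum>i\<in>I. F (\<beta> i))" for I :: "'e set" and \<beta>
    by (induction I rule: infinite_finite_induct) (auto simp: add zero Om_sum)
  have "F \<alpha> = F (fun_times_form (\<lambda>q. \<rho> q * \<rho> q) \<alpha>)"
    using times[OF smooth_fun_on_mult[OF open_UNIV bump_smooth[OF b] bump_smooth[OF b]] \<alpha>(1)]
      bump_centre[OF b] by simp
  also have "\<dots> = (\<Sum>i\<in>Basis. pairing \<alpha> (frame_field \<rho> U \<phi> i) p * F (frame_form \<rho> \<phi> i))"
    unfolding form_in_frame[OF b \<alpha>(1)]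
    by (simp add: sum times Om_times Om_smooth[OF \<alpha>(1)] frame_field_VF[OF b] frame_form_Om[OF b])
  also have "\<dots> = 0" using \<alpha>(2) by (simp add: pairing_def)
  finally show ?thesis .
qed

lemma cotangent_eqI:
  assumes "a \<in> cotangent_space A p" "b \<in> cotangent_space A p" "\<And>v. v \<in> tangent_space A p \<Longrightarrow> a v = b v"
  shows "a = b"
proof
  show "a v = b v" for v
    using assms(3) cotangent_outside[OF assms(1)] cotangent_outside[OF assms(2)]
    by (cases "v \<in> tangent_space A p") auto
qed

lemma one_form_eqI:
  assumes "\<alpha> \<in> Om" "\<beta> \<in> Om" "\<And>X. X \<in> VF \<Longrightarrow> pairing \<alpha> X = pairing \<beta> X"
  shows "\<alpha> = \<beta>"
proof (rule ext, rule cotangent_eqI)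
  fix p v assume "v \<in> tangent_space A p"
  then obtain X where "X \<in> VF" "X p = v" by (rule tangent_extend)
  then show "\<alpha> p v = \<beta> p v" using fun_cong[OF assms(3), of X p] by (simp add: pairing_def)
qed (use assms Om_cotangent in auto)

text \<open>Supplies existence and uniqueness for the description defining
  \<open>dual_connection\<close> and, through \<open>cov_deriv_one_form\<close>, existence for
  \<open>D_map\<close>. By tensoriality \<open>F X p\<close> depends on \<open>X p\<close> only, so
  a covector can be read off at each point from any field extending a given vector.\<close>

lemma ex1_one_form:
  fixes F :: "'m vfield \<Rightarrow> 'm \<Rightarrow> real"
  assumes add: "\<And>X Y p. X \<in> VF \<Longrightarrow> Y \<in> VF \<Longrightarrow> F (X + Y) p = F X p + F Y p"
    and times: "\<And>f X p. smooth_fun_on A UNIV f \<Longrightarrow> X \<in> VF \<Longrightarrow> F (fun_times_field f X) p = f p * F X p"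
    and smooth: "\<And>X. X \<in> VF \<Longrightarrow> smooth_fun_on A UNIV (F X)"
  shows "\<exists>!\<omega>. \<omega> \<in> Om \<and> (\<forall>X\<in>VF. pairing \<omega> X = F X)"
proof (rule ex_ex1I)
  \<comment> \<open>The difference of the two fields vanishes at \<open>p\<close>. It is written as
    a sum with -1 times \<open>Y\<close> because \<open>F\<close> is only known to respect sums and
    multiples by functions.\<close>
  have wd: "F X p = F Y p" if "X \<in> VF" "Y \<in> VF" "X p = Y p" for X Y p
  proof -
    let ?Z = "X + fun_times_field (\<lambda>q. - 1) Y"
    have m: "fun_times_field (\<lambda>q. - 1) Y \<in> VF" using VF_times[OF smooth_fun_on_const that(2)] .
    have "F ?Z p = 0"
      by (rule field_tensorial[where F = "\<lambda>X. F X p" and p = p])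
        (use add times VF_add[OF that(1) m] that(3) in
          \<open>auto simp: fun_times_field_def scale_fun_def fun_eq_iff\<close>)
    then show ?thesis using add[OF that(1) m] times[OF smooth_fun_on_const that(2)] by simp
  qed
  define \<omega> where "\<omega> p v = (if v \<in> tangent_space A p then F (SOME X. X \<in> VF \<and> X p = v) p else 0)" for p v
  have \<omega>: "\<omega> p (X p) = F X p" if "X \<in> VF" for X p
  proof -
    let ?Y = "SOME Y. Y \<in> VF \<and> Y p = X p"
    have "?Y \<in> VF \<and> ?Y p = X p"
      by (rule someI[of "\<lambda>Y. Y \<in> VF \<and> Y p = X p"]) (use that in simp)
    then have "F ?Y p = F X p" using wd that by blast
    then show ?thesis using VF_tangent[OF that] by (simp add: \<omega>_def)
  qed
  have "\<omega> p (v + w) = \<omega> p v + \<omega> p w" if vw: "v \<in> tangent_space A p" "w \<in> tangent_space A p" for p v w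
  proof -
    obtain X Y where "X \<in> VF" "X p = v" "Y \<in> VF" "Y p = w"
      using tangent_extend[OF vw(1)] tangent_extend[OF vw(2)] by metis
    then show ?thesis using \<omega>[of X p] \<omega>[of Y p] \<omega>[OF VF_add, of X Y p] add[of X Y p] by simp
  qed
  moreover have "\<omega> p (scale_fun r v) = r * \<omega> p v" if v: "v \<in> tangent_space A p" for p v r
  proof -
    obtain X where X: "X \<in> VF" "X p = v" by (rule tangent_extend[OF v])
    then show ?thesis
      using \<omega>[of X p] \<omega>[OF VF_times[OF smooth_fun_on_const[of _ r] X(1)], of p]
        times[OF smooth_fun_on_const[of _ r] X(1), of p]
      by (simp add: fun_times_field_def)
  qed
  ultimately have "\<omega> p \<in> cotangent_space A p" for p
    by (auto simp: cotangent_space_def linear_fun_on_def) (simp add: \<omega>_def)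
  moreover have "pairing \<omega> X = F X" if "X \<in> VF" for X
    using \<omega>[OF that] by (simp add: pairing_def)
  ultimately have "\<omega> \<in> Om \<and> (\<forall>X\<in>VF. pairing \<omega> X = F X)"
    using smooth by (auto simp: one_forms_def)
  then show "\<exists>\<omega>. \<omega> \<in> Om \<and> (\<forall>X\<in>VF. pairing \<omega> X = F X)" by blast
qed (auto intro: one_form_eqI)

text \<open>The differential of \<open>f\<close> at \<open>p\<close>. It is a covector even when
  \<open>f\<close> is not smooth near \<open>p\<close>, so two tangent vectors that agree under all
  these covectors agree as functions, without a side condition on \<open>f\<close>.\<close>

definition covec_d :: "'m \<Rightarrow> ('m \<Rightarrow> real) \<Rightarrow> 'm covec" where
  "covec_d p f = (\<lambda>v. if v \<in> tangent_space A p then v f else 0)"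

lemma covec_d_cotangent: "covec_d p f \<in> cotangent_space A p"
  by (auto simp: cotangent_space_def covec_d_def linear_fun_on_def tangent_space_add
      tangent_space_scale scale_fun_apply)

lemma cotangent_eq_covec_d:
  assumes a: "a \<in> cotangent_space A p"
  obtains f where "f \<in> smooth_near A p" "a = covec_d p f"
proof -
  obtain U \<phi> where c: "(U, \<phi>) \<in> A" "p \<in> U" by (rule chart_at)
  \<comment> \<open>The function that is linear in the chart, with the components of
    \<open>a\<close> as coefficients.\<close>
  define f where "f = (\<Sum>i\<in>Basis. scale_fun (a (coord_vec U \<phi> i p)) (\<lambda>q. \<phi> q \<bullet> i))"
  show ?thesis
  proof
    show "f \<in> smooth_near A p"
      unfolding f_def by (intro smooth_near_sum smooth_near_scale coord_smooth_near[OF c])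
    show "a = covec_d p f"
    proof (rule cotangent_eqI[OF a covec_d_cotangent])
      fix v assume v: "v \<in> tangent_space A p"
      then show "a v = covec_d p f v"
        unfolding covec_d_def f_def cotangent_in_coordinates[OF a v c]
        by (simp add: tangent_sum[OF v] tangent_scale[OF v] smooth_near_scale coord_smooth_near[OF c]
            mult.commute)
    qed
  qed
qed

text \<open>Finite-dimensional reflexivity without bases: the representing derivation is \<open>f \<mapsto> l (df)\<close>,
  and every covector is a differential.\<close>

lemma cotangent_dual_represented:
  assumes l: "linear_fun_on (cotangent_space A p) l"
  shows "\<exists>!v. v \<in> tangent_space A p \<and> (\<forall>b\<in>cotangent_space A p. b v = l b)"
proof (rule ex_ex1I)
  define v where "v f = (if f \<in> smooth_near A p then l (covec_d p f) else 0)" for f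
  have add: "l (a + b) = l a + l b"
    if "a \<in> cotangent_space A p" "b \<in> cotangent_space A p" for a b
    using l that by (auto simp: linear_fun_on_def)
  have scale: "l (scale_fun r a) = r * l a" if "a \<in> cotangent_space A p" for a r
    using l that by (auto simp: linear_fun_on_def)
  have d_add: "covec_d p (f + g) = covec_d p f + covec_d p g"
    if "f \<in> smooth_near A p" "g \<in> smooth_near A p" for f g
    using that by (auto simp: covec_d_def fun_eq_iff tangent_add)
  have d_scale: "covec_d p (scale_fun r f) = scale_fun r (covec_d p f)"
    if "f \<in> smooth_near A p" for f r
    using that by (auto simp: covec_d_def fun_eq_iff tangent_scale scale_fun_apply)
  have d_mult: "covec_d p (f * g) = scale_fun (f p) (covec_d p g) + scale_fun (g p) (covec_d p f)"
    if "f \<in> smooth_near A p" "g \<in> smooth_near A p" for f g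
    using that by (auto simp: covec_d_def fun_eq_iff tangent_mult scale_fun_def)
  have v: "v \<in> tangent_space A p"
    unfolding tangent_space_def linear_fun_on_def
    by (auto simp: v_def smooth_near_add smooth_near_scale smooth_near_mult d_add d_scale d_mult
        add scale covec_d_cotangent cotangent_space_scale)
  moreover have "b v = l b" if b: "b \<in> cotangent_space A p" for b
  proof -
    obtain f where "f \<in> smooth_near A p" "b = covec_d p f" by (rule cotangent_eq_covec_d[OF b])
    then show ?thesis using v by (simp add: covec_d_def v_def)
  qed
  ultimately show "\<exists>v. v \<in> tangent_space A p \<and> (\<forall>b\<in>cotangent_space A p. b v = l b)" by blast
next
  fix v w
  assume "v \<in> tangent_space A p \<and> (\<forall>b\<in>cotangent_space A p. b v = l b)"
    and "w \<in> tangent_space A p \<and> (\<forall>b\<in>cotangent_space A p. b w = l b)"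
  then have vw: "v \<in> tangent_space A p" "w \<in> tangent_space A p"
    and "covec_d p f v = covec_d p f w" for f
    using covec_d_cotangent by auto
  then show "v = w" by (simp add: covec_d_def fun_eq_iff)
qed

lemma Om_covec_d:
  assumes "smooth_fun_on A UNIV f"
  shows "(\<lambda>q. covec_d q f) \<in> Om"
proof -
  have "pairing (\<lambda>q. covec_d q f) X = apply_field X f" if "X \<in> VF" for X
    using VF_tangent[OF that] by (simp add: pairing_def covec_d_def apply_field_def)
  then show ?thesis
    using VF_smooth[OF _ open_UNIV assms] by (simp add: one_forms_def covec_d_cotangent)
qed

end

section \<open>Connections and symmetric bivector fields\<close>

locale connection_manifold = smooth_manifold A
  for A :: "('m::t2_space, 'e::euclidean_space) chart set" +
  fixes nabla :: "'m connection"
  assumes connection: "is_connection A nabla"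
begin

lemma nabla_VF: "X \<in> VF \<Longrightarrow> Y \<in> VF \<Longrightarrow> nabla X Y \<in> VF"
  and nabla_add_left: "X \<in> VF \<Longrightarrow> X' \<in> VF \<Longrightarrow> Y \<in> VF \<Longrightarrow> nabla (X + X') Y = nabla X Y + nabla X' Y"
  and nabla_add_right: "X \<in> VF \<Longrightarrow> Y \<in> VF \<Longrightarrow> Y' \<in> VF \<Longrightarrow> nabla X (Y + Y') = nabla X Y + nabla X Y'"
  and nabla_times_left: "smooth_fun_on A UNIV f \<Longrightarrow> X \<in> VF \<Longrightarrow> Y \<in> VF \<Longrightarrow>
    nabla (fun_times_field f X) Y = fun_times_field f (nabla X Y)"
  and nabla_times_right: "smooth_fun_on A UNIV f \<Longrightarrow> X \<in> VF \<Longrightarrow> Y \<in> VF \<Longrightarrow>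
    nabla X (fun_times_field f Y) = fun_times_field f (nabla X Y) + fun_times_field (apply_field X f) Y"
  using connection unfolding is_connection_def by blast+

lemma fun_times_field_apply: "fun_times_field f X p g = f p * X p g"
  by (simp add: fun_times_field_def scale_fun_apply)

lemma pairing_add: "\<alpha> \<in> Om \<Longrightarrow> X \<in> VF \<Longrightarrow> Y \<in> VF \<Longrightarrow> \<alpha> p ((X + Y) p) = \<alpha> p (X p) + \<alpha> p (Y p)"
  using cotangent_add[OF Om_cotangent VF_tangent VF_tangent] by simp

lemma pairing_times: "\<alpha> \<in> Om \<Longrightarrow> X \<in> VF \<Longrightarrow> \<alpha> p (fun_times_field f X p) = f p * \<alpha> p (X p)"
  using cotangent_scale[OF Om_cotangent VF_tangent] by (simp add: fun_times_field_def)

lemma smooth_near_global: "smooth_fun_on A UNIV f \<Longrightarrow> f \<in> smooth_near A p"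
  by (rule smooth_nearI[OF _ open_UNIV UNIV_I])

text \<open>When \<open>Y\<close> is multiplied by \<open>f\<close>, the derivative of the pairing
  and the pairing with the covariant derivative both acquire the term \<open>X f\<close> times the
  pairing of \<beta> with \<open>Y\<close>. These cancel, so the difference is linear over functions
  in \<open>Y\<close> and defines a one-form.\<close>

lemma dual_connection_spec:
  assumes X: "X \<in> VF" and \<beta>: "\<beta> \<in> Om"
  shows "dual_connection A nabla X \<beta> \<in> Om \<and> (\<forall>Y\<in>VF. pairing (dual_connection A nabla X \<beta>) Y
      = apply_field X (pairing \<beta> Y) - pairing \<beta> (nabla X Y))"
  unfolding dual_connection_def
proof (rule theI'[OF ex1_one_form])
  fix Y p assume Y: "Y \<in> VF"
  note near = smooth_near_global[OF Om_smooth[OF \<beta>], of _ p]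
  show "(apply_field X (pairing \<beta> (Y + Y')) - pairing \<beta> (nabla X (Y + Y'))) p
    = (apply_field X (pairing \<beta> Y) - pairing \<beta> (nabla X Y)) p
    + (apply_field X (pairing \<beta> Y') - pairing \<beta> (nabla X Y')) p" if Y': "Y' \<in> VF" for Y'
  proof -
    have "pairing \<beta> (Y + Y') = pairing \<beta> Y + pairing \<beta> Y'"
      using pairing_add[OF \<beta> Y Y'] by (simp add: pairing_def fun_eq_iff)
    then show ?thesis
      using tangent_add[OF VF_tangent[OF X] near[OF Y] near[OF Y']]
        pairing_add[OF \<beta> nabla_VF[OF X Y] nabla_VF[OF X Y']]
      by (simp add: apply_field_def nabla_add_right[OF X Y Y'] pairing_def)
  qed
  show "(apply_field X (pairing \<beta> (fun_times_field f Y)) - pairing \<beta> (nabla X (fun_times_field f Y))) p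
    = f p * (apply_field X (pairing \<beta> Y) - pairing \<beta> (nabla X Y)) p"
    if f: "smooth_fun_on A UNIV f" for f
  proof -
    have "pairing \<beta> (fun_times_field f Y) = f * pairing \<beta> Y"
      using pairing_times[OF \<beta> Y] by (simp add: pairing_def fun_eq_iff)
    moreover have "\<beta> p (nabla X (fun_times_field f Y) p)
        = f p * \<beta> p (nabla X Y p) + apply_field X f p * \<beta> p (Y p)"
      unfolding nabla_times_right[OF f X Y]
      using pairing_add[OF \<beta> VF_times[OF f nabla_VF[OF X Y]] VF_times[OF VF_smooth[OF X open_UNIV f] Y]]
        pairing_times[OF \<beta> nabla_VF[OF X Y]] pairing_times[OF \<beta> Y] by simp
    ultimately show ?thesis
      using tangent_mult[OF VF_tangent[OF X] smooth_near_global[OF f] near[OF Y]]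
      by (simp add: apply_field_def pairing_def algebra_simps)
  qed
  show "smooth_fun_on A UNIV (apply_field X (pairing \<beta> Y) - pairing \<beta> (nabla X Y))"
    using smooth_fun_on_diff[OF open_UNIV VF_smooth[OF X open_UNIV Om_smooth[OF \<beta> Y]]
        Om_smooth[OF \<beta> nabla_VF[OF X Y]]] by (simp add: fun_diff_def)
qed

lemma dual_connection_Om: "X \<in> VF \<Longrightarrow> \<beta> \<in> Om \<Longrightarrow> dual_connection A nabla X \<beta> \<in> Om"
  using dual_connection_spec by blast

lemma dual_connection_pairing:
  "X \<in> VF \<Longrightarrow> \<beta> \<in> Om \<Longrightarrow> Y \<in> VF \<Longrightarrow>
    dual_connection A nabla X \<beta> p (Y p) = X p (pairing \<beta> Y) - \<beta> p (nabla X Y p)"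
  using dual_connection_spec[of X \<beta>] by (auto simp: pairing_def apply_field_def fun_eq_iff)

lemma dual_connection_add:
  assumes "X \<in> VF" "X' \<in> VF" "\<beta> \<in> Om"
  shows "dual_connection A nabla (X + X') \<beta> = dual_connection A nabla X \<beta> + dual_connection A nabla X' \<beta>"
proof (rule one_form_eqI)
  fix Y assume Y: "Y \<in> VF"
  have "dual_connection A nabla (X + X') \<beta> p (Y p)
    = (dual_connection A nabla X \<beta> + dual_connection A nabla X' \<beta>) p (Y p)" for p
    using pairing_add[OF assms(3) nabla_VF[OF assms(1) Y] nabla_VF[OF assms(2) Y], of p]
    by (simp add: dual_connection_pairing VF_add assms Y nabla_add_left)
  then show "pairing (dual_connection A nabla (X + X') \<beta>) Y
    = pairing (dual_connection A nabla X \<beta> + dual_connection A nabla X' \<beta>) Y"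
    by (simp add: pairing_def)
qed (use assms in \<open>auto intro: dual_connection_Om VF_add Om_add\<close>)

lemma dual_connection_times:
  assumes "X \<in> VF" "smooth_fun_on A UNIV f" "\<beta> \<in> Om"
  shows "dual_connection A nabla (fun_times_field f X) \<beta> = fun_times_form f (dual_connection A nabla X \<beta>)"
proof (rule one_form_eqI)
  fix Y assume Y: "Y \<in> VF"
  have "dual_connection A nabla (fun_times_field f X) \<beta> p (Y p)
    = fun_times_form f (dual_connection A nabla X \<beta>) p (Y p)" for p
    using pairing_times[OF assms(3) nabla_VF[OF assms(1) Y]]
    by (simp add: dual_connection_pairing VF_times assms Y nabla_times_left fun_times_form_def
        fun_times_field_apply scale_fun_apply right_diff_distrib)
  then show "pairing (dual_connection A nabla (fun_times_field f X) \<beta>) Y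
    = pairing (fun_times_form f (dual_connection A nabla X \<beta>)) Y"
    by (simp add: pairing_def)
qed (use assms in \<open>auto intro: dual_connection_Om VF_times Om_times\<close>)

text \<open>The term differentiating the pairing is \<open>X p\<close> applied to a function, hence
  0. The other term is linear over functions in \<open>X\<close>, so \<open>field_tensorial\<close>
  makes it vanish too.\<close>

lemma dual_connection_zero_at:
  assumes X: "X \<in> VF" "X p = 0" and \<beta>: "\<beta> \<in> Om"
  shows "dual_connection A nabla X \<beta> p = 0"
proof (rule cotangent_eqI[OF Om_cotangent[OF dual_connection_Om[OF X(1) \<beta>]] cotangent_space_zero])
  fix v assume "v \<in> tangent_space A p"
  then obtain Y where Y: "Y \<in> VF" "Y p = v" by (rule tangent_extend)
  have "\<beta> p (nabla X Y p) = 0"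
  proof (rule field_tensorial[where F = "\<lambda>X. \<beta> p (nabla X Y p)", OF _ _ X])
    show "\<beta> p (nabla (X + X') Y p) = \<beta> p (nabla X Y p) + \<beta> p (nabla X' Y p)"
      if "X \<in> VF" "X' \<in> VF" for X X'
      using nabla_add_left[OF that Y(1)]
        pairing_add[OF \<beta> nabla_VF[OF that(1) Y(1)] nabla_VF[OF that(2) Y(1)]] by simp
    show "\<beta> p (nabla (fun_times_field f X) Y p) = f p * \<beta> p (nabla X Y p)"
      if "smooth_fun_on A UNIV f" "X \<in> VF" for f X
      using nabla_times_left[OF that Y(1)] pairing_times[OF \<beta> nabla_VF[OF that(2) Y(1)]] by simp
  qed
  then show "dual_connection A nabla X \<beta> p v = 0 v"
    using dual_connection_pairing[OF X(1) \<beta> Y(1), of p] Y(2) X(2) by simp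
qed

end

section \<open>Symmetric bivector fields, the sharp map and its kernel\<close>

locale bivector_manifold = connection_manifold A nabla
  for A :: "('m::t2_space, 'e::euclidean_space) chart set" and nabla +
  fixes h :: "'m bivector"
  assumes bivector: "symmetric_bivector_field A h"
begin

lemma h_sym: "a \<in> cotangent_space A p \<Longrightarrow> b \<in> cotangent_space A p \<Longrightarrow> h p a b = h p b a"
  and h_linear: "a \<in> cotangent_space A p \<Longrightarrow> linear_fun_on (cotangent_space A p) (h p a)"
  and h_smooth: "\<alpha> \<in> Om \<Longrightarrow> \<beta> \<in> Om \<Longrightarrow> smooth_fun_on A UNIV (eval_bivector h \<alpha> \<beta>)"
  using bivector unfolding symmetric_bivector_field_def by blast+

lemma h_add_right: "a \<in> cotangent_space A p \<Longrightarrow> b \<in> cotangent_space A p \<Longrightarrow> c \<in> cotangent_space A p \<Longrightarrow>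
    h p a (b + c) = h p a b + h p a c"
  and h_scale_right: "a \<in> cotangent_space A p \<Longrightarrow> b \<in> cotangent_space A p \<Longrightarrow>
    h p a (scale_fun r b) = r * h p a b"
  using h_linear by (auto simp: linear_fun_on_def)

lemma h_add_left: "a \<in> cotangent_space A p \<Longrightarrow> b \<in> cotangent_space A p \<Longrightarrow> c \<in> cotangent_space A p \<Longrightarrow>
    h p (b + c) a = h p b a + h p c a"
  using h_sym[of _ p a] h_add_right cotangent_space_add by simp

lemma h_scale_left: "a \<in> cotangent_space A p \<Longrightarrow> b \<in> cotangent_space A p \<Longrightarrow>
    h p (scale_fun r b) a = r * h p b a"
  using h_sym[of _ p a] h_scale_right cotangent_space_scale by simp

lemma h_zero_right: "a \<in> cotangent_space A p \<Longrightarrow> h p a 0 = 0"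
  using h_scale_right[of a p 0 0] cotangent_space_zero by (simp add: scale_fun_def zero_fun_def)

lemma sharp_spec:
  assumes "a \<in> cotangent_space A p"
  shows "sharp A h p a \<in> tangent_space A p \<and> (\<forall>b\<in>cotangent_space A p. b (sharp A h p a) = h p a b)"
  unfolding sharp_def by (rule theI'[OF cotangent_dual_represented[OF h_linear[OF assms]]])

lemma sharp_tangent: "a \<in> cotangent_space A p \<Longrightarrow> sharp A h p a \<in> tangent_space A p"
  and sharp_pairing: "a \<in> cotangent_space A p \<Longrightarrow> b \<in> cotangent_space A p \<Longrightarrow> b (sharp A h p a) = h p a b"
  using sharp_spec by blast+

text \<open>Replaces the description inside \<open>sharp\<close> by a condition on \<open>h\<close>.
  Differentials serve as test covectors: pairing with \<open>covec_d p f\<close> reads off the value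
  of the sharp vector at \<open>f\<close>.\<close>

lemma isotropy_iff:
  "a \<in> isotropy A h p \<longleftrightarrow> a \<in> cotangent_space A p \<and> (\<forall>b\<in>cotangent_space A p. h p a b = 0)"
proof (cases "a \<in> cotangent_space A p")
  case True
  have "sharp A h p a = 0" if z: "\<forall>b\<in>cotangent_space A p. h p a b = 0"
  proof
    fix f
    have "covec_d p f (sharp A h p a) = 0"
      using z sharp_pairing[OF True covec_d_cotangent] covec_d_cotangent by simp
    then show "sharp A h p a f = 0 f"
      using sharp_tangent[OF True] by (simp add: covec_d_def)
  qed
  moreover have "h p a b = 0" if "sharp A h p a = 0" "b \<in> cotangent_space A p" for b
    using sharp_pairing[OF True that(2)] that(1) cotangent_zero[OF that(2)] by simp
  ultimately show ?thesis using True by (auto simp: isotropy_def)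
qed (simp add: isotropy_def)

lemma isotropyD:
  assumes "a \<in> isotropy A h p"
  shows "a \<in> cotangent_space A p" "sharp A h p a = 0"
    "b \<in> cotangent_space A p \<Longrightarrow> h p a b = 0" "b \<in> cotangent_space A p \<Longrightarrow> h p b a = 0"
  using assms h_sym[of b p a] by (simp_all add: isotropy_iff) (use assms in \<open>simp add: isotropy_def\<close>)

text \<open>Smoothness of \<open>h\<close> is stated for global one-forms, while \<open>f\<close>
  lives on \<open>W\<close> only. Near each point \<open>f\<close> is replaced by a global
  \<open>F\<close>; there the sharp field applied to \<open>f\<close> is \<open>h\<close> evaluated
  on \<alpha> and the differential of \<open>F\<close>.\<close>

lemma sharp_field_VF:
  assumes \<alpha>: "\<alpha> \<in> Om"
  shows "sharp_field A h \<alpha> \<in> VF"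
proof -
  note \<alpha>c = Om_cotangent[OF \<alpha>]
  have "smooth_fun_on A W (apply_field (sharp_field A h \<alpha>) f)"
    if W: "open W" and f: "smooth_fun_on A W f" for W f
  proof (rule smooth_fun_on_local)
    fix p assume "p \<in> W"
    then obtain F N where F: "smooth_fun_on A UNIV F" "open N" "p \<in> N" "N \<subseteq> W" "\<And>q. q \<in> N \<Longrightarrow> F q = f q"
      using smooth_fun_globalize[OF f W] by metis
    have "smooth_fun_on A N (eval_bivector h \<alpha> (\<lambda>q. covec_d q F))"
      using smooth_fun_on_subset[OF h_smooth[OF \<alpha> Om_covec_d[OF F(1)]]] by simp
    then have "smooth_fun_on A N (apply_field (sharp_field A h \<alpha>) f)"
    proof (rule smooth_fun_on_cong[OF _ F(2)])
      fix q assume q: "q \<in> N"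
      have "eval_bivector h \<alpha> (\<lambda>q. covec_d q F) q = sharp A h q (\<alpha> q) F"
        using sharp_pairing[OF \<alpha>c covec_d_cotangent] sharp_tangent[OF \<alpha>c]
        by (simp add: eval_bivector_def covec_d_def)
      also have "\<dots> = sharp A h q (\<alpha> q) f"
        by (rule tangent_cong[OF sharp_tangent[OF \<alpha>c] smooth_near_global[OF F(1)] F(2) q F(5)])
      finally show "eval_bivector h \<alpha> (\<lambda>q. covec_d q F) q = apply_field (sharp_field A h \<alpha>) f q"
        by (simp add: apply_field_def sharp_field_def)
    qed
    then show "\<exists>N. open N \<and> p \<in> N \<and> smooth_fun_on A N (apply_field (sharp_field A h \<alpha>) f)"
      using F by blast
  qed
  then show ?thesis
    using sharp_tangent[OF \<alpha>c] by (simp add: vector_fields_def sharp_field_def)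
qed

lemma sharp_field_pairing:
  "\<alpha> \<in> Om \<Longrightarrow> \<beta> \<in> Om \<Longrightarrow> eval_bivector h \<alpha> \<beta> = pairing \<beta> (sharp_field A h \<alpha>)"
  using sharp_pairing[OF Om_cotangent Om_cotangent]
  by (simp add: eval_bivector_def pairing_def sharp_field_def fun_eq_iff)

text \<open>The direction \<open>X\<close> enters through the derivation \<open>X p\<close> and
  through the lower slot of the dual connection, and both are linear over functions; thus the
  covariant derivative, as a function of \<open>X\<close>, is a genuine global one-form.\<close>

lemma cov_deriv_one_form:
  assumes \<alpha>: "\<alpha> \<in> Om" and \<beta>: "\<beta> \<in> Om"
  obtains \<tau> where "\<tau> \<in> Om" "\<And>X. X \<in> VF \<Longrightarrow> pairing \<tau> X = cov_deriv_bivector A nabla h X \<alpha> \<beta>"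
proof -
  have "\<exists>!\<tau>. \<tau> \<in> Om \<and> (\<forall>X\<in>VF. pairing \<tau> X = cov_deriv_bivector A nabla h X \<alpha> \<beta>)"
  proof (rule ex1_one_form)
    fix X p assume X: "X \<in> VF"
    note c = Om_cotangent[OF \<alpha>, of p] Om_cotangent[OF \<beta>, of p]
    show "cov_deriv_bivector A nabla h (X + Y) \<alpha> \<beta> p
        = cov_deriv_bivector A nabla h X \<alpha> \<beta> p + cov_deriv_bivector A nabla h Y \<alpha> \<beta> p"
      if Y: "Y \<in> VF" for Y
      using X Y \<alpha> \<beta> c Om_cotangent[OF dual_connection_Om, of _ _ p]
      by (simp add: cov_deriv_bivector_def apply_field_def eval_bivector_def dual_connection_add
          h_add_left h_add_right)
    show "cov_deriv_bivector A nabla h (fun_times_field f X) \<alpha> \<beta> p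
        = f p * cov_deriv_bivector A nabla h X \<alpha> \<beta> p" if f: "smooth_fun_on A UNIV f" for f
      using X f \<alpha> \<beta> c Om_cotangent[OF dual_connection_Om, of _ _ p]
      by (simp add: cov_deriv_bivector_def apply_field_def eval_bivector_def dual_connection_times
          fun_times_field_apply fun_times_form_def h_scale_left h_scale_right algebra_simps)
    show "smooth_fun_on A UNIV (cov_deriv_bivector A nabla h X \<alpha> \<beta>)"
      using smooth_fun_on_diff[OF open_UNIV smooth_fun_on_diff[OF open_UNIV
            VF_smooth[OF X open_UNIV h_smooth[OF \<alpha> \<beta>]]
            h_smooth[OF dual_connection_Om[OF X \<alpha>] \<beta>]] h_smooth[OF \<alpha> dual_connection_Om[OF X \<beta>]]]
      by (simp add: cov_deriv_bivector_def fun_diff_def)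
  qed
  then show ?thesis using that by blast
qed

text \<open>In each correction term one slot of \<open>h\<close> holds a dual derivative and the
  other a kernel covector.\<close>

lemma cov_deriv_isotropy:
  assumes "\<alpha> \<in> Om" "\<beta> \<in> Om" "X \<in> VF" "\<alpha> p \<in> isotropy A h p" "\<beta> p \<in> isotropy A h p"
  shows "cov_deriv_bivector A nabla h X \<alpha> \<beta> p = X p (eval_bivector h \<alpha> \<beta>)"
  using isotropyD(3)[OF assms(4) Om_cotangent[OF dual_connection_Om[OF assms(3,2)]]]
    isotropyD(4)[OF assms(5) Om_cotangent[OF dual_connection_Om[OF assms(3,1)]]]
  by (simp add: cov_deriv_bivector_def eval_bivector_def apply_field_def)

lemma D_map_spec:
  assumes \<alpha>: "\<alpha> \<in> Om" and \<beta>: "\<beta> \<in> Om"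
  shows "D_map A nabla h \<alpha> \<beta> \<in> Om \<and> (\<forall>X\<in>VF. pairing (D_map A nabla h \<alpha> \<beta>) X =
        cov_deriv_bivector A nabla h X \<alpha> \<beta>
        + pairing (dual_connection A nabla (sharp_field A h \<alpha>) \<beta>) X)"
proof -
  let ?P = "\<lambda>\<omega>. \<omega> \<in> Om \<and> (\<forall>X\<in>VF. pairing \<omega> X = cov_deriv_bivector A nabla h X \<alpha> \<beta>
        + pairing (dual_connection A nabla (sharp_field A h \<alpha>) \<beta>) X)"
  obtain \<tau> where \<tau>: "\<tau> \<in> Om" "\<And>X. X \<in> VF \<Longrightarrow> pairing \<tau> X = cov_deriv_bivector A nabla h X \<alpha> \<beta>"
    using cov_deriv_one_form[OF assms] by metis
  have "?P (\<tau> + dual_connection A nabla (sharp_field A h \<alpha>) \<beta>)"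
    using Om_add[OF \<tau>(1) dual_connection_Om[OF sharp_field_VF[OF \<alpha>] \<beta>]]
    by (auto simp: \<tau>(2)[symmetric] pairing_def)
  moreover have "\<omega> = \<omega>'" if "?P \<omega>" "?P \<omega>'" for \<omega> \<omega>'
    by (rule one_form_eqI) (use that in simp_all)
  ultimately have "\<exists>!\<omega>. ?P \<omega>" by blast
  from theI'[OF this] show ?thesis unfolding D_map_def .
qed

lemma D_map_at_isotropy:
  assumes "\<alpha> \<in> Om" "\<beta> \<in> Om" "\<alpha> p \<in> isotropy A h p" "\<beta> p \<in> isotropy A h p" "v \<in> tangent_space A p"
  shows "D_map A nabla h \<alpha> \<beta> p v = v (eval_bivector h \<alpha> \<beta>)"
proof -
  obtain X where X: "X \<in> VF" "X p = v" by (rule tangent_extend[OF assms(5)])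
  have "dual_connection A nabla (sharp_field A h \<alpha>) \<beta> p = 0"
    using isotropyD(2)[OF assms(3)]
    by (intro dual_connection_zero_at sharp_field_VF assms) (simp add: sharp_field_def)
  then have "D_map A nabla h \<alpha> \<beta> p (X p) = cov_deriv_bivector A nabla h X \<alpha> \<beta> p"
    using D_map_spec[OF assms(1,2)] X(1) by (auto simp: pairing_def fun_eq_iff)
  then show ?thesis using cov_deriv_isotropy[OF assms(1,2) X(1) assms(3,4)] X(2) by simp
qed

text \<open>The derivative of \<open>h(\<alpha>, \<beta>)\<close> is not tensorial in \<alpha> in
  general: multiplying \<alpha> by \<open>f\<close> adds \<open>v f\<close> times the value of
  \<open>h(\<alpha>, \<beta>)\<close> at \<open>p\<close>. That value is 0 when
  \<open>\<beta> p\<close> is in the kernel, so \<open>form_tensorial\<close> applies to the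
  difference of \<alpha> and \<alpha>'.\<close>

lemma derivative_bivector_tensorial:
  assumes \<alpha>: "\<alpha> \<in> Om" and \<alpha>': "\<alpha>' \<in> Om" and eq: "\<alpha> p = \<alpha>' p"
    and \<beta>: "\<beta> \<in> Om" "\<beta> p \<in> isotropy A h p" and v: "v \<in> tangent_space A p"
  shows "v (eval_bivector h \<alpha> \<beta>) = v (eval_bivector h \<alpha>' \<beta>)"
proof -
  let ?F = "\<lambda>\<alpha>. v (eval_bivector h \<alpha> \<beta>)"
  have near: "eval_bivector h \<alpha> \<beta> \<in> smooth_near A p" if "\<alpha> \<in> Om" for \<alpha>
    using smooth_near_global[OF h_smooth[OF that \<beta>(1)]] .
  have add: "?F (\<alpha> + \<alpha>') = ?F \<alpha> + ?F \<alpha>'" if "\<alpha> \<in> Om" "\<alpha>' \<in> Om" for \<alpha> \<alpha>'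
  proof -
    have "eval_bivector h (\<alpha> + \<alpha>') \<beta> = eval_bivector h \<alpha> \<beta> + eval_bivector h \<alpha>' \<beta>"
      using h_add_left that \<beta>(1) Om_cotangent by (simp add: eval_bivector_def fun_eq_iff)
    then show ?thesis using tangent_add[OF v near near] that by simp
  qed
  have times: "?F (fun_times_form f \<alpha>) = f p * ?F \<alpha>" if f: "smooth_fun_on A UNIV f" and "\<alpha> \<in> Om" for f \<alpha>
  proof -
    have "eval_bivector h (fun_times_form f \<alpha>) \<beta> = f * eval_bivector h \<alpha> \<beta>"
      using h_scale_left that \<beta>(1) Om_cotangent
      by (simp add: eval_bivector_def fun_eq_iff fun_times_form_def)
    then show ?thesis
      using tangent_mult[OF v smooth_near_global[OF f] near[OF that(2)]]
        isotropyD(4)[OF \<beta>(2) Om_cotangent[OF that(2)]] by (simp add: eval_bivector_def)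
  qed
  let ?m = "fun_times_form (\<lambda>q. - 1) \<alpha>'"
  have m: "?m \<in> Om" by (rule Om_times[OF smooth_fun_on_const \<alpha>'])
  have "?F (\<alpha> + ?m) = 0"
    by (rule form_tensorial[where p = p, OF add times Om_add[OF \<alpha> m]])
      (simp_all add: eq fun_times_form_def scale_fun_def fun_eq_iff)
  then show ?thesis using add[OF \<alpha> m] times[OF smooth_fun_on_const \<alpha>', of "- 1"] by simp
qed

lemma eval_bivector_commute: "\<alpha> \<in> Om \<Longrightarrow> \<beta> \<in> Om \<Longrightarrow> eval_bivector h \<alpha> \<beta> = eval_bivector h \<beta> \<alpha>"
  using h_sym[OF Om_cotangent Om_cotangent] by (simp add: eval_bivector_def fun_eq_iff)

text \<open>The extensions are exchanged one at a time. Tensoriality is available in the first slot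
  of \<open>h\<close>, so symmetry brings \<beta> there for the second exchange.\<close>

lemma D_map_well_defined:
  assumes a: "a \<in> isotropy A h p" and b: "b \<in> isotropy A h p"
    and \<alpha>: "\<alpha> \<in> Om" "\<alpha> p = a" and \<alpha>': "\<alpha>' \<in> Om" "\<alpha>' p = a"
    and \<beta>: "\<beta> \<in> Om" "\<beta> p = b" and \<beta>': "\<beta>' \<in> Om" "\<beta>' p = b"
  shows "D_map A nabla h \<alpha> \<beta> p = D_map A nabla h \<alpha>' \<beta>' p"
proof (rule cotangent_eqI)
  fix v assume v: "v \<in> tangent_space A p"
  have "v (eval_bivector h \<alpha> \<beta>) = v (eval_bivector h \<alpha>' \<beta>)"
    by (rule derivative_bivector_tensorial[where p = p]) (use assms v in auto)
  also have "\<dots> = v (eval_bivector h \<beta> \<alpha>')" using eval_bivector_commute \<alpha>' \<beta> by simp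
  also have "\<dots> = v (eval_bivector h \<beta>' \<alpha>')"
    by (rule derivative_bivector_tensorial[where p = p]) (use assms v in auto)
  also have "\<dots> = v (eval_bivector h \<alpha>' \<beta>')" using eval_bivector_commute \<alpha>' \<beta>' by simp
  finally show "D_map A nabla h \<alpha> \<beta> p v = D_map A nabla h \<alpha>' \<beta>' p v"
    using assms v by (simp add: D_map_at_isotropy)
qed (use D_map_spec Om_cotangent \<alpha> \<alpha>' \<beta> \<beta>' in blast)+

lemma ex1_product_value:
  assumes a: "a \<in> isotropy A h p" and b: "b \<in> isotropy A h p"
  shows "\<exists>!c. is_product_value A nabla h p a b c"
proof (rule ex_ex1I)
  obtain \<alpha> where "\<alpha> \<in> Om" "\<alpha> p = a" by (rule cotangent_extend[OF isotropyD(1)[OF a]])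
  moreover obtain \<beta> where "\<beta> \<in> Om" "\<beta> p = b" by (rule cotangent_extend[OF isotropyD(1)[OF b]])
  ultimately show "\<exists>c. is_product_value A nabla h p a b c"
    unfolding is_product_value_def by blast
next
  fix c c' assume "is_product_value A nabla h p a b c" "is_product_value A nabla h p a b c'"
  then show "c = c'"
    unfolding is_product_value_def using D_map_well_defined[OF a b] by blast
qed

lemma isotropy_product_eq:
  assumes "\<alpha> \<in> Om" "\<beta> \<in> Om" "\<alpha> p \<in> isotropy A h p" "\<beta> p \<in> isotropy A h p"
  shows "isotropy_product A nabla h p (\<alpha> p) (\<beta> p) = D_map A nabla h \<alpha> \<beta> p"
  unfolding isotropy_product_def
  by (rule the1_equality[OF ex1_product_value[OF assms(3,4)]])
    (use assms in \<open>auto simp: is_product_value_def\<close>)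

lemma isotropy_extend:
  assumes "a \<in> isotropy A h p"
  obtains \<alpha> where "\<alpha> \<in> Om" "\<alpha> p = a"
  using cotangent_extend isotropyD(1)[OF assms] by blast

lemma isotropy_product_cotangent:
  assumes "a \<in> isotropy A h p" "b \<in> isotropy A h p"
  shows "isotropy_product A nabla h p a b \<in> cotangent_space A p"
proof -
  obtain \<alpha> \<beta> where "\<alpha> \<in> Om" "\<alpha> p = a" "\<beta> \<in> Om" "\<beta> p = b"
    using isotropy_extend[OF assms(1)] isotropy_extend[OF assms(2)] by metis
  then show ?thesis
    using isotropy_product_eq assms D_map_spec Om_cotangent by metis
qed

lemma isotropy_product_apply:
  assumes "\<alpha> \<in> Om" "\<beta> \<in> Om" "\<alpha> p \<in> isotropy A h p" "\<beta> p \<in> isotropy A h p" "v \<in> tangent_space A p"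
  shows "isotropy_product A nabla h p (\<alpha> p) (\<beta> p) v = v (eval_bivector h \<alpha> \<beta>)"
  using isotropy_product_eq[OF assms(1-4)] D_map_at_isotropy[OF assms] by simp

section \<open>Linear structure of the kernel, commutativity and bilinearity\<close>

lemma isotropy_add: "a \<in> isotropy A h p \<Longrightarrow> b \<in> isotropy A h p \<Longrightarrow> a + b \<in> isotropy A h p"
  by (simp add: isotropy_iff cotangent_space_add h_add_left)

lemma isotropy_scale: "a \<in> isotropy A h p \<Longrightarrow> scale_fun r a \<in> isotropy A h p"
  by (simp add: isotropy_iff cotangent_space_scale h_scale_left)

lemma isotropy_subspace: "fun_vs.subspace (isotropy A h p)"
proof -
  have "0 \<in> isotropy A h p"
    using h_zero_right h_sym[OF cotangent_space_zero] by (simp add: isotropy_iff cotangent_space_zero)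
  then show ?thesis by (simp add: fun_vs.subspace_def isotropy_add isotropy_scale)
qed

lemma isotropy_product_commute:
  assumes a: "a \<in> isotropy A h p" and b: "b \<in> isotropy A h p"
  shows "isotropy_product A nabla h p a b = isotropy_product A nabla h p b a"
proof -
  obtain \<alpha> \<beta> where f: "\<alpha> \<in> Om" "\<alpha> p = a" "\<beta> \<in> Om" "\<beta> p = b"
    using isotropy_extend[OF a] isotropy_extend[OF b] by metis
  show ?thesis
  proof (rule cotangent_eqI[OF isotropy_product_cotangent[OF a b] isotropy_product_cotangent[OF b a]])
    fix v assume "v \<in> tangent_space A p"
    then show "isotropy_product A nabla h p a b v = isotropy_product A nabla h p b a v"
      using isotropy_product_apply[of \<alpha> \<beta> p v] isotropy_product_apply[of \<beta> \<alpha> p v]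
        eval_bivector_commute[of \<alpha> \<beta>] f a b by simp
  qed
qed

lemma isotropy_product_add:
  assumes a: "a \<in> isotropy A h p" and b: "b \<in> isotropy A h p" and c: "c \<in> isotropy A h p"
  shows "isotropy_product A nabla h p (a + b) c
    = isotropy_product A nabla h p a c + isotropy_product A nabla h p b c"
proof -
  obtain \<alpha> \<beta> \<gamma> where f: "\<alpha> \<in> Om" "\<alpha> p = a" "\<beta> \<in> Om" "\<beta> p = b" "\<gamma> \<in> Om" "\<gamma> p = c"
    using isotropy_extend[OF a] isotropy_extend[OF b] isotropy_extend[OF c] by metis
  show ?thesis
  proof (rule cotangent_eqI)
    fix v assume v: "v \<in> tangent_space A p"
    have "eval_bivector h (\<alpha> + \<beta>) \<gamma> = eval_bivector h \<alpha> \<gamma> + eval_bivector h \<beta> \<gamma>"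
      using h_add_left f Om_cotangent by (simp add: eval_bivector_def fun_eq_iff)
    moreover have "isotropy_product A nabla h p (a + b) c v = v (eval_bivector h (\<alpha> + \<beta>) \<gamma>)"
      using isotropy_product_apply[of "\<alpha> + \<beta>" \<gamma> p v] f a b c v by (simp add: Om_add isotropy_add)
    ultimately show "isotropy_product A nabla h p (a + b) c v
      = (isotropy_product A nabla h p a c + isotropy_product A nabla h p b c) v"
      using isotropy_product_apply[of \<alpha> \<gamma> p v] isotropy_product_apply[of \<beta> \<gamma> p v] f a b c v
        tangent_add[OF v smooth_near_global[OF h_smooth] smooth_near_global[OF h_smooth]] by simp
  qed (use assms in \<open>auto intro!: isotropy_product_cotangent isotropy_add cotangent_space_add\<close>)
qed

lemma isotropy_product_scale:
  assumes a: "a \<in> isotropy A h p" and b: "b \<in> isotropy A h p"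
  shows "isotropy_product A nabla h p (scale_fun r a) b = scale_fun r (isotropy_product A nabla h p a b)"
proof -
  obtain \<alpha> \<beta> where f: "\<alpha> \<in> Om" "\<alpha> p = a" "\<beta> \<in> Om" "\<beta> p = b"
    using isotropy_extend[OF a] isotropy_extend[OF b] by metis
  let ?r = "fun_times_form (\<lambda>q. r) \<alpha>"
  have r: "?r \<in> Om" "?r p = scale_fun r a"
    using Om_times[OF smooth_fun_on_const f(1)] f(2) by (simp_all add: fun_times_form_def)
  show ?thesis
  proof (rule cotangent_eqI)
    fix v assume v: "v \<in> tangent_space A p"
    have "eval_bivector h ?r \<beta> = scale_fun r (eval_bivector h \<alpha> \<beta>)"
      using h_scale_left f Om_cotangent
      by (simp add: eval_bivector_def fun_eq_iff fun_times_form_def scale_fun_apply)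
    moreover have "isotropy_product A nabla h p (scale_fun r a) b v = v (eval_bivector h ?r \<beta>)"
      using isotropy_product_apply[of ?r \<beta> p v] r f a b v by (simp add: isotropy_scale)
    ultimately show "isotropy_product A nabla h p (scale_fun r a) b v
      = scale_fun r (isotropy_product A nabla h p a b) v"
      using isotropy_product_apply[of \<alpha> \<beta> p v] f a b v
        tangent_scale[OF v smooth_near_global[OF h_smooth]] by (simp add: scale_fun_apply)
  qed (use assms in \<open>auto intro!: isotropy_product_cotangent isotropy_scale cotangent_space_scale\<close>)
qed

end

section \<open>The isotropy algebra\<close>

locale pseudo_Hessian_manifold = bivector_manifold A nabla h
  for A :: "('m::t2_space, 'e::euclidean_space) chart set" and nabla h +
  assumes Codazzi: "\<alpha> \<in> one_forms A \<Longrightarrow> \<beta> \<in> one_forms A \<Longrightarrow> \<gamma> \<in> one_forms A \<Longrightarrow>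
    cov_deriv_bivector A nabla h (sharp_field A h \<alpha>) \<beta> \<gamma> =
    cov_deriv_bivector A nabla h (sharp_field A h \<beta>) \<alpha> \<gamma>"
begin

text \<open>Pairing \<open>a.b\<close> with the sharp of an arbitrary \<gamma> is a covariant
  derivative of \<open>h\<close> along that vector field. Codazzi exchanges \<gamma> with \<alpha>,
  so the direction becomes the sharp of \<alpha>, which is zero at \<open>p\<close>.\<close>

lemma isotropy_product_closed:
  assumes a: "a \<in> isotropy A h p" and b: "b \<in> isotropy A h p"
  shows "isotropy_product A nabla h p a b \<in> isotropy A h p"
proof -
  note ab = isotropy_product_cotangent[OF a b]
  obtain \<alpha> \<beta> where f: "\<alpha> \<in> Om" "\<alpha> p = a" "\<beta> \<in> Om" "\<beta> p = b"
    using isotropy_extend[OF a] isotropy_extend[OF b] by metis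
  have "h p (isotropy_product A nabla h p a b) c = 0" if c: "c \<in> cotangent_space A p" for c
  proof -
    obtain \<gamma> where \<gamma>: "\<gamma> \<in> Om" "\<gamma> p = c" by (rule cotangent_extend[OF c])
    let ?\<alpha> = "sharp_field A h \<alpha>" and ?\<gamma> = "sharp_field A h \<gamma>"
    have \<alpha>0: "?\<alpha> p = 0" using isotropyD(2)[OF a] f by (simp add: sharp_field_def)
    have "h p (isotropy_product A nabla h p a b) c = isotropy_product A nabla h p a b (?\<gamma> p)"
      using h_sym[OF ab c] sharp_pairing[OF c ab] \<gamma> by (simp add: sharp_field_def)
    also have "\<dots> = ?\<gamma> p (eval_bivector h \<alpha> \<beta>)"
      using isotropy_product_apply[OF f(1,3), of p "?\<gamma> p"] f a b VF_tangent[OF sharp_field_VF[OF \<gamma>(1)]] by simp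
    also have "\<dots> = cov_deriv_bivector A nabla h ?\<gamma> \<alpha> \<beta> p"
      using cov_deriv_isotropy[OF f(1,3) sharp_field_VF[OF \<gamma>(1)]] f a b by simp
    also have "\<dots> = cov_deriv_bivector A nabla h ?\<alpha> \<gamma> \<beta> p"
      using Codazzi[OF \<gamma>(1) f(1,3)] by simp
    \<comment> \<open>Along a direction that vanishes at \<open>p\<close>, the derivation is the
      zero vector and both dual derivatives vanish at \<open>p\<close>.\<close>
    also have "\<dots> = 0"
      using dual_connection_zero_at[OF sharp_field_VF[OF f(1)] \<alpha>0] \<gamma> f \<alpha>0 h_zero_right[OF c]
        isotropyD(4)[OF b cotangent_space_zero]
      by (simp add: cov_deriv_bivector_def eval_bivector_def apply_field_def)
    finally show ?thesis .
  qed
  then show ?thesis using ab by (simp add: isotropy_iff)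
qed

text \<open>Below, \<open>\<tau>\<close> and \<open>\<sigma>\<close> are the one-forms \<open>T(\<beta>, \<gamma>)\<close> and \<open>T(\<alpha>, \<gamma>)\<close>.\<close>

lemma isotropy_product_left_commute:
  assumes a: "a \<in> isotropy A h p" and b: "b \<in> isotropy A h p" and c: "c \<in> isotropy A h p"
  shows "isotropy_product A nabla h p a (isotropy_product A nabla h p b c)
    = isotropy_product A nabla h p b (isotropy_product A nabla h p a c)"
proof -
  obtain \<alpha> \<beta> \<gamma> where f: "\<alpha> \<in> Om" "\<alpha> p = a" "\<beta> \<in> Om" "\<beta> p = b" "\<gamma> \<in> Om" "\<gamma> p = c"
    using isotropy_extend[OF a] isotropy_extend[OF b] isotropy_extend[OF c] by metis
  \<comment> \<open>Any extension of \<open>b.c\<close> may be used to compute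
    \<open>a.(b.c)\<close>. This one is chosen because Codazzi speaks about it away from
    \<open>p\<close> too.\<close>
  have ext: "\<exists>\<tau>. \<tau> \<in> Om \<and> \<tau> p = isotropy_product A nabla h p (\<beta> p) c
      \<and> (\<forall>X\<in>VF. pairing \<tau> X = cov_deriv_bivector A nabla h X \<beta> \<gamma>)"
    if \<beta>: "\<beta> \<in> Om" "\<beta> p \<in> isotropy A h p" for \<beta>
  proof -
    obtain \<tau> where \<tau>: "\<tau> \<in> Om" "\<And>X. X \<in> VF \<Longrightarrow> pairing \<tau> X = cov_deriv_bivector A nabla h X \<beta> \<gamma>"
      using cov_deriv_one_form[OF \<beta>(1) f(5)] by metis
    have "\<tau> p = isotropy_product A nabla h p (\<beta> p) c"
    proof (rule cotangent_eqI[OF Om_cotangent[OF \<tau>(1)] isotropy_product_cotangent[OF \<beta>(2) c]])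
      fix v assume v: "v \<in> tangent_space A p"
      obtain X where X: "X \<in> VF" "X p = v" by (rule tangent_extend[OF v])
      have "\<tau> p v = cov_deriv_bivector A nabla h X \<beta> \<gamma> p"
        using fun_cong[OF \<tau>(2)[OF X(1)], of p] X(2) by (simp add: pairing_def)
      then show "\<tau> p v = isotropy_product A nabla h p (\<beta> p) c v"
        using cov_deriv_isotropy[OF \<beta>(1) f(5) X(1)] isotropy_product_apply[OF \<beta>(1) f(5) \<beta>(2) _ v]
          \<beta> c f X by simp
    qed
    then show ?thesis using \<tau> by blast
  qed
  obtain \<tau> where \<tau>: "\<tau> \<in> Om" "\<tau> p = isotropy_product A nabla h p b c"
    "\<And>X. X \<in> VF \<Longrightarrow> pairing \<tau> X = cov_deriv_bivector A nabla h X \<beta> \<gamma>"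
    using ext[OF f(3)] f(4) b by auto
  obtain \<sigma> where \<sigma>: "\<sigma> \<in> Om" "\<sigma> p = isotropy_product A nabla h p a c"
    "\<And>X. X \<in> VF \<Longrightarrow> pairing \<sigma> X = cov_deriv_bivector A nabla h X \<alpha> \<gamma>"
    using ext[OF f(1)] f(2) a by auto
  \<comment> \<open>\<open>h(\<alpha>, \<tau>)\<close> is \<tau> paired with the sharp of \<alpha>,
    which is the covariant derivative of \<open>h\<close> in that direction on \<beta> and \<gamma>.
    Codazzi is an equality of functions on the whole manifold, so both sides may be differentiated
    at \<open>p\<close>.\<close>
  have eq: "eval_bivector h \<alpha> \<tau> = eval_bivector h \<beta> \<sigma>"
    using Codazzi[OF f(1,3,5)] f \<tau> \<sigma> by (simp add: sharp_field_pairing sharp_field_VF)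
  \<comment> \<open>Closure is what allows the product formula to be applied to \<tau> and \<sigma>:
    their values at \<open>p\<close> must lie in the kernel.\<close>
  note bc = isotropy_product_closed[OF b c] and ac = isotropy_product_closed[OF a c]
  show ?thesis
  proof (rule cotangent_eqI[OF isotropy_product_cotangent[OF a bc] isotropy_product_cotangent[OF b ac]])
    fix v assume v: "v \<in> tangent_space A p"
    show "isotropy_product A nabla h p a (isotropy_product A nabla h p b c) v
      = isotropy_product A nabla h p b (isotropy_product A nabla h p a c) v"
      using isotropy_product_apply[OF f(1) \<tau>(1) _ _ v] isotropy_product_apply[OF f(3) \<sigma>(1) _ _ v]
        f \<tau>(2) \<sigma>(2) a b bc ac eq by simp
  qed
qed

text \<open>(a.b).c = c.(a.b) = a.(c.b) = a.(b.c), where the middle equality is left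
  commutativity.\<close>

lemma isotropy_product_assoc:
  assumes a: "a \<in> isotropy A h p" and b: "b \<in> isotropy A h p" and c: "c \<in> isotropy A h p"
  shows "isotropy_product A nabla h p (isotropy_product A nabla h p a b) c
    = isotropy_product A nabla h p a (isotropy_product A nabla h p b c)"
  using isotropy_product_commute[OF isotropy_product_closed[OF a b] c]
    isotropy_product_left_commute[OF c a b] isotropy_product_commute[OF b c] by simp

lemma isotropy_algebra: "comm_assoc_algebra (isotropy A h p) (isotropy_product A nabla h p)"
  unfolding comm_assoc_algebra_def
proof (intro conjI allI ballI)
  fix a b assume a: "a \<in> isotropy A h p" and b: "b \<in> isotropy A h p"
  show "isotropy_product A nabla h p a (scale_fun r b) = scale_fun r (isotropy_product A nabla h p a b)" for r
    using isotropy_product_scale[OF b a]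
    by (simp only: isotropy_product_commute[OF a isotropy_scale[OF b]] isotropy_product_commute[OF a b])
  show "isotropy_product A nabla h p c (a + b)
      = isotropy_product A nabla h p c a + isotropy_product A nabla h p c b"
    if c: "c \<in> isotropy A h p" for c
    using isotropy_product_add[OF a b c]
    by (simp only: isotropy_product_commute[OF c isotropy_add[OF a b]]
        isotropy_product_commute[OF c a] isotropy_product_commute[OF c b])
qed (simp_all add: isotropy_subspace isotropy_product_closed isotropy_product_add
      isotropy_product_scale isotropy_product_assoc isotropy_product_commute[of _ p])

end

theorem proposition7p1:
  fixes A :: "('m::{t2_space, second_countable_topology}, 'e::euclidean_space) chart set"
    and nabla :: "'m connection" and h :: "'m bivector" and x :: 'm
  assumes "smooth_atlas A"
    and "generalized_pseudo_Hessian A nabla h"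
  shows "(\<forall>a\<in>isotropy A h x. \<forall>b\<in>isotropy A h x.
            \<exists>!c. is_product_value A nabla h x a b c) \<and>
         comm_assoc_algebra (isotropy A h x) (isotropy_product A nabla h x)"
proof -
  interpret pseudo_Hessian_manifold A nabla h
    using assms unfolding generalized_pseudo_Hessian_def by unfold_locales blast+
  show ?thesis using ex1_product_value isotropy_algebra by blast
qed

end
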